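(* Let $\lambda\in\mathbb{Z}_+^n$, $\gamma\in\mathbb{Z}_+^m$, and let $T:\mathbb{R}^\lambda[x_1,\dots,x_n]\to\mathbb{R}^\gamma[x_1,\dots,x_m]$ be a linear operator mapping polynomials with non-negative coefficients to polynomials with non-negative coefficients, such that for every fixed $x\in\mathbb{R}_+^m$ the polynomial $\mathrm{Symb}^\lambda(T)(z,x)$ is real stable in $z=(z_1,\dots,z_n)$. Let $\alpha\in\mathbb{R}_+^n$ with $\alpha\le\lambda$ and $\beta\in\mathbb{R}_+^m$. Then for every real stable $p\in\mathbb{R}_+^\lambda[x_1,\dots,x_n]$ with $\alpha\in\mathrm{Newt}(p)$, $$\frac{\mathrm{Cap}_\beta(T(p))}{\mathrm{Cap}_\alpha(p)}\ \ge\ \frac{\alpha^\alpha(\lambda-\alpha)^{\lambda-\alpha}}{\lambda^\lambda}\,\mathrm{Cap}_{(\alpha,\beta)}\big(\mathrm{Symb}^\lambda(T)\big).$$ Further, this bound is tight for fixed $T,\alpha,\beta$: the infimum of the left-hand side over all real stable $p\in\mathbb{R}_+^\lambda[x_1,\dots,x_n]$ with $\alpha\in\mathrm{Newt}(p)$ equals the right-hand side.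
   Context: $\mathbb{R}_+$ and $\mathbb{Z}_+$ denote the non-negative reals and integers. $\mathbb{R}^\lambda[x_1,\dots,x_n]$ is the space of real polynomials of degree at most $\lambda_k$ in $x_k$ for each $k$; $\mathbb{R}_+^\lambda[x_1,\dots,x_n]$ is the subset of those with non-negative coefficients. A real polynomial is real stable if it is identically zero or does not vanish when all variables lie in the open upper half-plane. Multi-index notation: $x^\alpha=\prod_k x_k^{\alpha_k}$, $\alpha^\alpha=\prod_k\alpha_k^{\alpha_k}$, $(\lambda-\alpha)^{\lambda-\alpha}=\prod_k(\lambda_k-\alpha_k)^{\lambda_k-\alpha_k}$, $\lambda^\lambda=\prod_k\lambda_k^{\lambda_k}$, with $0^0=1$; $\alpha\le\lambda$ is entrywise; $\binom{\lambda}{\mu}=\prod_k\binom{\lambda_k}{\mu_k}$. The capacity of a polynomial $p$ with non-negative coefficients is $\mathrm{Cap}_\alpha(p)=\inf_{x_1,\dots,x_n>0}p(x)/x^\alpha$. $\mathrm{Newt}(p)$ is the convex hull of the set of exponents $\mu$ of monomials with non-zero coefficient in $p$; for $\alpha\in\mathrm{Newt}(p)$ one has $\mathrm{Cap}_\alpha(p)>0$. The symbol of $T$ is $\mathrm{Symb}^\lambda(T)(z,x)=\sum_{0\le\mu\le\lambda}\binom{\lambda}{\mu}z^\mu\,T(x^\mu)$, a polynomial in $z_1,\dots,z_n,x_1,\dots,x_m$ with non-negative coefficients, and $\mathrm{Cap}_{(\alpha,\beta)}(\mathrm{Symb}^\lambda(T))=\inf_{z>0,\,x>0}\mathrm{Symb}^\lambda(T)(z,x)/(z^\alpha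 x^\beta)$. *)

theory Defs
  imports "HOL-Analysis.Analysis" "HOL-Library.Poly_Mapping"
begin

text \<open>A real polynomial in variables indexed by a finite type is the finitely supported map
  from its exponent vectors to its coefficients.\<close>

type_synonym 'n rpoly = "(nat ^ 'n) \<Rightarrow>\<^sub>0 real"

abbreviation monomial :: "nat ^ 'n \<Rightarrow> real \<Rightarrow> 'n::finite rpoly" where
  "monomial \<mu> c \<equiv> Poly_Mapping.single \<mu> c"

definition poly_scale :: "real \<Rightarrow> 'n::finite rpoly \<Rightarrow> 'n rpoly" where
  "poly_scale c p = monomial 0 c * p"

definition real_vec :: "nat ^ 'n \<Rightarrow> real ^ 'n::finite" where
  "real_vec \<mu> = (\<chi> i. real (\<mu> $ i))"

definition poly_eval :: "'n::finite rpoly \<Rightarrow> 'a ^ 'n \<Rightarrow> 'a::{real_algebra_1, comm_ring_1}" where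
  "poly_eval p z =
     (\<Sum>\<mu>\<in>Poly_Mapping.keys p. of_real (Poly_Mapping.lookup p \<mu>) * (\<Prod>i\<in>UNIV. (z $ i) ^ (\<mu> $ i)))"

definition polys_le :: "nat ^ 'n \<Rightarrow> 'n::finite rpoly set" where
  "polys_le lam = {p. \<forall>\<mu>\<in>Poly_Mapping.keys p. \<mu> \<le> lam}"

definition nonneg_polys_le :: "nat ^ 'n \<Rightarrow> 'n::finite rpoly set" where
  "nonneg_polys_le lam = {p \<in> polys_le lam. \<forall>\<mu>. 0 \<le> Poly_Mapping.lookup p \<mu>}"

definition real_stable :: "'n::finite rpoly \<Rightarrow> bool" where
  "real_stable p \<longleftrightarrow>
     p = 0 \<or> (\<forall>z :: complex ^ 'n. (\<forall>i. 0 < Im (z $ i)) \<longrightarrow> poly_eval p z \<noteq> 0)"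

definition Newt :: "'n::finite rpoly \<Rightarrow> (real ^ 'n) set" where
  "Newt p = convex hull (real_vec ` Poly_Mapping.keys p)"

text \<open>For non-negative coefficients the infimum is over a nonempty set of non-negative reals.\<close>

definition Cap :: "real ^ 'n \<Rightarrow> 'n::finite rpoly \<Rightarrow> real" where
  "Cap \<alpha> p =
     (INF x\<in>{x :: real ^ 'n. \<forall>i. 0 < x $ i}. poly_eval p x / (\<Prod>i\<in>UNIV. (x $ i) powr (\<alpha> $ i)))"

text \<open>The product of all \<open>v\<^sub>i\<^sup>v\<^sup>i\<close> with the convention that zero to the zero is one; the case
  distinction is needed because \<open>0 powr 0 = 0\<close>.\<close>

definition self_power :: "real ^ 'n::finite \<Rightarrow> real" where
  "self_power v = (\<Prod>i\<in>UNIV. if v $ i = 0 then 1 else (v $ i) powr (v $ i))"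

definition vec_binomial :: "nat ^ 'n \<Rightarrow> nat ^ 'n::finite \<Rightarrow> nat" where
  "vec_binomial lam \<mu> = (\<Prod>i\<in>UNIV. (lam $ i) choose (\<mu> $ i))"

definition linear_on_polys_le ::
    "nat ^ 'n \<Rightarrow> ('n::finite rpoly \<Rightarrow> 'm::finite rpoly) \<Rightarrow> bool" where
  "linear_on_polys_le lam T \<longleftrightarrow>
     (\<forall>p\<in>polys_le lam. \<forall>q\<in>polys_le lam. T (p + q) = T p + T q) \<and>
     (\<forall>c. \<forall>p\<in>polys_le lam. T (poly_scale c p) = poly_scale c (T p))"

text \<open>Polynomials in \<open>z\<close> and \<open>x\<close> jointly have their variables indexed by a sum type:
  \<open>Inl i\<close> stands for \<open>z\<^sub>i\<close> and \<open>Inr j\<close> for \<open>x\<^sub>j\<close>.\<close>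

definition vec_join :: "'a ^ 'n \<Rightarrow> 'a ^ 'm \<Rightarrow> 'a ^ ('n::finite + 'm::finite)" where
  "vec_join u v = (\<chi> s. case s of Inl i \<Rightarrow> u $ i | Inr j \<Rightarrow> v $ j)"

definition lift_right :: "'m::finite rpoly \<Rightarrow> ('n::finite + 'm) rpoly" where
  "lift_right q = (\<Sum>\<nu>\<in>Poly_Mapping.keys q. monomial (vec_join 0 \<nu>) (Poly_Mapping.lookup q \<nu>))"

definition Symb ::
    "nat ^ 'n \<Rightarrow> ('n::finite rpoly \<Rightarrow> 'm::finite rpoly) \<Rightarrow> ('n + 'm) rpoly" where
  "Symb lam T =
     (\<Sum>\<mu>\<in>{\<mu>. \<mu> \<le> lam}.
        monomial (vec_join \<mu> 0) (real (vec_binomial lam \<mu>)) * lift_right (T (monomial \<mu> 1)))"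

text \<open>The polynomial in \<open>z\<close> obtained by fixing the value of \<open>x\<close>.\<close>

definition fix_right :: "('n::finite + 'm::finite) rpoly \<Rightarrow> real ^ 'm \<Rightarrow> 'n rpoly" where
  "fix_right q x =
     (\<Sum>\<kappa>\<in>Poly_Mapping.keys q.
        monomial (\<chi> i. \<kappa> $ Inl i)
          (Poly_Mapping.lookup q \<kappa> * (\<Prod>j\<in>UNIV. (x $ j) ^ (\<kappa> $ Inr j))))"

text \<open>The sum defining the symbol ranges over a finite set.\<close>

lemma finite_vec_nat_atMost: "finite {\<mu> :: nat ^ 'n::finite. \<mu> \<le> lam}"
proof -
  have "finite (Pi\<^sub>E UNIV (\<lambda>i. {.. lam $ i}))"
    by (intro finite_PiE) auto
  moreover have "vec_nth ` {\<mu>. \<mu> \<le> lam} \<subseteq> Pi\<^sub>E UNIV (\<lambda>i. {.. lam $ i})"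
    by (auto simp: less_eq_vec_def)
  ultimately have "finite (vec_nth ` {\<mu>. \<mu> \<le> lam})"
    by (rule rev_finite_subset)
  then show ?thesis
    by (rule finite_imageD) (auto intro: inj_onI simp: vec_nth_inject)
qed

end

theory Submission
  imports Defs "HOL-Computational_Algebra.Fundamental_Theorem_Algebra"
begin

text \<open>For fixed \<open>x > 0\<close> the value \<open>T(p)(x)\<close> is the pairing
  \<open>\<langle>p, q\<rangle> = \<Sum>\<^sub>\<mu> p\<^sub>\<mu> q\<^sub>\<mu> / binom(\<lambda>, \<mu>)\<close> of \<open>p\<close> with \<open>q = Symb(T)(\<cdot>, x)\<close>, so the lower bound is the
  capacity inequality for \<open>\<langle>p, q\<rangle>\<close> with \<open>p\<close> and \<open>q\<close> stable. Start from \<open>p(y) q(z)\<close>, which does not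
  vanish for \<open>Im y > 0 > Im z\<close>, and lower the degree in one pair \<open>(y\<^sub>i, z\<^sub>i)\<close> by one at a time: polarize one
  factor of \<open>y\<^sub>i\<close> and one of \<open>z\<^sub>i\<close> (Laguerre's theorem keeps the polynomial nonvanishing, AM-GM keeps
  the capacity), which gives a bilinear polynomial \<open>a + b y' + c z' + d y' z'\<close>, and replace it by \<open>a + d\<close>.
  Nonvanishing forces \<open>b c \<le> a d\<close> at positive real points, and then a bound
  \<open>K (y' z')\<^sup>s \<le> a + b y' + c z' + d y' z'\<close> implies \<open>K s\<^sup>s (1 - s)\<^bsup>1 - s\<^esup> \<le> a + d\<close>. Equality in the
  infimum is approached by the polynomials \<open>\<Prod>\<^sub>i (1 + y\<^sub>i x\<^sub>i)\<^bsup>\<lambda>\<^sub>i\<^esup>\<close> with \<open>y > 0\<close>.\<close>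

section \<open>Laguerre's theorem for a half-plane\<close>

text \<open>Inversion carries the half-plane \<open>y \<le> Im u\<close> to a disc with 0 on its
  boundary: after squaring, the quadratic terms in \<open>u\<close> cancel and a linear condition on
  \<open>Im u\<close> remains.\<close>

lemma inverse_in_disc_iff:
  fixes u :: complex
  assumes "y > 0" "u \<noteq> 0"
  shows "cmod (1 / u + \<i> / (2 * of_real y)) \<le> 1 / (2 * y) \<longleftrightarrow> y \<le> Im u"
proof -
  have "1 / u + \<i> / (2 * of_real y) = (2 * of_real y + \<i> * u) / (2 * of_real y * u)"
    using assms by (simp add: field_simps)
  then have "cmod (1 / u + \<i> / (2 * of_real y)) = cmod (2 * of_real y + \<i> * u) / (2 * y * cmod u)"
    using assms by (simp add: norm_divide norm_mult)
  also have "\<dots> \<le> 1 / (2 * y) \<longleftrightarrow> cmod (2 * of_real y + \<i> * u) \<le> cmod u"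
    using assms by (simp add: field_simps)
  also have "\<dots> \<longleftrightarrow> (cmod (2 * of_real y + \<i> * u))\<^sup>2 \<le> (cmod u)\<^sup>2"
    by (simp add: power2_le_iff_abs_le)
  also have "\<dots> \<longleftrightarrow> 4 * y * y \<le> 4 * y * Im u"
    unfolding cmod_power2 by (simp add: power2_eq_square algebra_simps)
  also have "\<dots> \<longleftrightarrow> y \<le> Im u"
    using assms by simp
  finally show ?thesis .
qed

text \<open>The logarithmic derivative is the sum of \<open>1 / (z - r)\<close> over the roots
  \<open>r\<close>. Every root has \<open>Im r \<le> 0\<close>, hence
  \<open>Im z \<le> Im (z - r)\<close>, and each summand lies in the disc of
  \<open>inverse_in_disc_iff\<close>. The induction splits off one root at a time.\<close>

lemma logarithmic_derivative_in_disc: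
  fixes p :: "complex poly"
  assumes "Im z > 0" "\<And>w. Im w > 0 \<Longrightarrow> poly p w \<noteq> 0"
  shows "cmod (poly (pderiv p) z / poly p z + of_nat (degree p) * (\<i> / (2 * of_real (Im z))))
           \<le> real (degree p) * (1 / (2 * Im z))"
  using assms(2)
proof (induction "degree p" arbitrary: p)
  case 0
  then have "pderiv p = 0"
    by (simp add: pderiv_eq_0_iff)
  then show ?case
    using 0 by simp
next
  case (Suc d)
  then have "\<not> constant (poly p)"
    by (metis constant_degree nat.distinct(1))
  then obtain r where r: "poly p r = 0"
    using fundamental_theorem_of_algebra by blast
  then obtain q where q: "p = [:- r, 1:] * q"
    by (metis dvdE poly_eq_0_iff_dvd)
  have "q \<noteq> 0"
    using q Suc.hyps(2) by auto
  then have deg: "degree p = Suc (degree q)"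
    using q by (simp add: degree_mult_eq del: mult_pCons_left)
  have qnz: "poly q w \<noteq> 0" if "Im w > 0" for w
    using Suc.prems[OF that] q by auto
  have IH: "cmod (poly (pderiv q) z / poly q z + of_nat (degree q) * (\<i> / (2 * of_real (Im z))))
           \<le> real (degree q) * (1 / (2 * Im z))"
    using Suc.hyps(1)[of q] deg Suc.hyps(2) qnz by auto
  have "Im r \<le> 0"
    using Suc.prems r by force
  have zr: "z - r \<noteq> 0"
    using \<open>Im r \<le> 0\<close> assms(1) by auto
  have "poly (pderiv p) z = poly q z + (z - r) * poly (pderiv q) z"
    unfolding q pderiv_mult by (simp add: pderiv_pCons algebra_simps)
  moreover have "poly p z = (z - r) * poly q z"
    unfolding q by (simp add: algebra_simps)
  ultimately have "poly (pderiv p) z / poly p z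
      = (poly q z + (z - r) * poly (pderiv q) z) / ((z - r) * poly q z)"
    by simp
  also have "\<dots> = 1 / (z - r) + poly (pderiv q) z / poly q z"
    using zr qnz[OF assms(1)] by (simp add: add_divide_distrib)
  finally have "poly (pderiv p) z / poly p z = 1 / (z - r) + poly (pderiv q) z / poly q z" .
  then have "poly (pderiv p) z / poly p z + of_nat (degree p) * (\<i> / (2 * of_real (Im z)))
     = (1 / (z - r) + \<i> / (2 * of_real (Im z)))
       + (poly (pderiv q) z / poly q z + of_nat (degree q) * (\<i> / (2 * of_real (Im z))))"
    by (simp add: deg algebra_simps add_divide_distrib)
  also have "cmod \<dots> \<le> 1 / (2 * Im z) + real (degree q) * (1 / (2 * Im z))"
    using inverse_in_disc_iff[of "Im z" "z - r"] assms(1) zr \<open>Im r \<le> 0\<close>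
    by (intro norm_triangle_mono IH) auto
  also have "\<dots> = real (degree p) * (1 / (2 * Im z))"
    by (simp add: deg algebra_simps add_divide_distrib)
  finally show ?case .
qed

text \<open>A zero would make the logarithmic derivative equal to \<open>N / (z - \<zeta>)\<close>.
  This puts \<open>1 / (z - \<zeta>)\<close> into the disc, so
  \<open>Im z \<le> Im (z - \<zeta>)\<close>, contrary to \<open>Im \<zeta> > 0\<close>.\<close>

lemma laguerre_half_plane:
  fixes p :: "complex poly"
  assumes "degree p \<le> N" "N > 0" "Im z > 0" "Im \<zeta> > 0"
    and nz: "\<And>w. Im w > 0 \<Longrightarrow> poly p w \<noteq> 0"
  shows "of_nat N * poly p z + (\<zeta> - z) * poly (pderiv p) z \<noteq> 0"
proof
  assume eq: "of_nat N * poly p z + (\<zeta> - z) * poly (pderiv p) z = 0"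
  have pz: "poly p z \<noteq> 0"
    using nz assms(3) by blast
  define c where "c = \<i> / (2 * of_real (Im z))"
  define S where "S = poly (pderiv p) z / poly p z"
  have cn: "cmod c = 1 / (2 * Im z)"
    using assms(3) by (simp add: c_def norm_divide)
  have "z \<noteq> \<zeta>"
    using eq pz assms(2) by auto
  have S: "S = of_nat N * (1 / (z - \<zeta>))"
    using eq pz \<open>z \<noteq> \<zeta>\<close> unfolding S_def by (simp add: field_simps)
  \<comment> \<open>The \<open>N - degree p\<close> missing roots count as roots at infinity: each
    contributes the point 0, which lies on the boundary of the disc.\<close>
  have "S + of_nat N * c = (S + of_nat (degree p) * c) + of_nat (N - degree p) * c"
    using assms(1) by (simp add: of_nat_diff algebra_simps)
  also have "cmod \<dots> \<le> real (degree p) * (1 / (2 * Im z)) + real (N - degree p) * (1 / (2 * Im z))"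
  proof (rule norm_triangle_mono)
    show "cmod (S + of_nat (degree p) * c) \<le> real (degree p) * (1 / (2 * Im z))"
      unfolding S_def c_def by (rule logarithmic_derivative_in_disc[OF assms(3) nz])
    show "cmod (of_nat (N - degree p) * c) \<le> real (N - degree p) * (1 / (2 * Im z))"
      unfolding norm_mult cn by simp
  qed
  also have "\<dots> = real N * (1 / (2 * Im z))"
    using assms(1) by (simp add: of_nat_diff algebra_simps diff_divide_distrib)
  finally have "cmod (of_nat N * (1 / (z - \<zeta>) + c)) \<le> real N * (1 / (2 * Im z))"
    unfolding S by (simp add: algebra_simps)
  then have "cmod (1 / (z - \<zeta>) + c) \<le> 1 / (2 * Im z)"
    using assms(2) by (simp only: norm_mult norm_of_nat mult_le_cancel_left_pos of_nat_0_less_iff)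
  then have "Im z \<le> Im (z - \<zeta>)"
    using inverse_in_disc_iff[of "Im z" "z - \<zeta>"] assms(3) \<open>z \<noteq> \<zeta>\<close> by (simp add: c_def)
  then show False
    using assms(4) by simp
qed

text \<open>\<open>polar_pow N k w \<zeta>\<close> is the polarization of \<open>w\<^sup>k\<close>, seen as a form of degree \<open>N\<close>,
  with one argument equal to \<open>\<zeta>\<close> and the remaining \<open>N - 1\<close> arguments equal to \<open>w\<close>.\<close>

definition polar_pow :: "nat \<Rightarrow> nat \<Rightarrow> 'a::field_char_0 \<Rightarrow> 'a \<Rightarrow> 'a" where
  "polar_pow N k w \<zeta> =
     (1 - of_nat k / of_nat N) * w ^ k + of_nat k / of_nat N * w ^ (k - 1) * \<zeta>"

text \<open>Multiplied by \<open>N\<close>, the polarized sum is exactly the expression in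
  Laguerre's theorem.\<close>

lemma polar_nonvanishing_upper:
  fixes c :: "nat \<Rightarrow> complex"
  assumes nz: "\<And>w. Im w > 0 \<Longrightarrow> (\<Sum>k\<le>N. c k * w ^ k) \<noteq> 0"
    and "N > 0" "Im w > 0" "Im \<zeta> > 0"
  shows "(\<Sum>k\<le>N. c k * polar_pow N k w \<zeta>) \<noteq> 0"
proof -
  define p where "p = (\<Sum>k\<le>N. monom (c k) k)"
  have p: "poly p z = (\<Sum>k\<le>N. c k * z ^ k)" for z
    by (simp add: p_def poly_sum poly_monom)
  have p': "poly (pderiv p) z = (\<Sum>k\<le>N. c k * of_nat k * z ^ (k - 1))" for z
    by (simp add: p_def poly_sum poly_monom higher_pderiv_sum[of 1, simplified] pderiv_monom mult_ac)
  have deg: "degree p \<le> N"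
    unfolding p_def by (intro degree_sum_le) (auto intro: order.trans[OF degree_monom_le])
  \<comment> \<open>This covers \<open>k = 0\<close> as well, where the exponent
    \<open>k - 1\<close> is truncated but the factor \<open>of_nat k\<close> vanishes.\<close>
  have eq: "w * w ^ (k - 1) * of_nat k = w ^ k * of_nat k" for k
    by (cases k) auto
  have "of_nat N * (c k * polar_pow N k w \<zeta>)
      = of_nat N * (c k * w ^ k) + (\<zeta> - w) * (c k * of_nat k * w ^ (k - 1))" for k
  proof -
    have "of_nat N * (c k * polar_pow N k w \<zeta>) = of_nat N * (c k * w ^ k)
        + c k * (\<zeta> * of_nat k * w ^ (k - 1)) - c k * (w ^ k * of_nat k)"
      using \<open>N > 0\<close> by (simp add: polar_pow_def field_simps)
    then show ?thesis
      unfolding eq[symmetric] by (simp add: algebra_simps)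
  qed
  then have "of_nat N * (\<Sum>k\<le>N. c k * polar_pow N k w \<zeta>)
      = of_nat N * poly p w + (\<zeta> - w) * poly (pderiv p) w"
    by (simp add: p p' sum_distrib_left sum.distrib)
  then show ?thesis
    using laguerre_half_plane[OF deg \<open>N > 0\<close> assms(3,4)] nz p by auto
qed

text \<open>The reflection of \<open>w\<close> to \<open>- w\<close>, absorbed by the signs
  \<open>(-1) ^ k\<close>, reduces this to the upper half-plane.\<close>

lemma polar_nonvanishing_lower:
  fixes c :: "nat \<Rightarrow> complex"
  assumes nz: "\<And>w. Im w < 0 \<Longrightarrow> (\<Sum>k\<le>N. c k * w ^ k) \<noteq> 0"
    and "N > 0" "Im w < 0" "Im \<zeta> < 0"
  shows "(\<Sum>k\<le>N. c k * polar_pow N k w \<zeta>) \<noteq> 0"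
proof -
  have "(\<Sum>k\<le>N. ((-1) ^ k * c k) * polar_pow N k (- w) (- \<zeta>)) \<noteq> 0"
  proof (rule polar_nonvanishing_upper)
    fix v :: complex assume "Im v > 0"
    then show "(\<Sum>k\<le>N. (-1) ^ k * c k * v ^ k) \<noteq> 0"
      using nz[of "- v"] by (simp add: power_minus[of v] mult_ac)
  qed (use assms in auto)
  moreover have "((-1) ^ k * c k) * polar_pow N k (- w) (- \<zeta>) = c k * polar_pow N k w \<zeta>" for k
  proof -
    have "polar_pow N k (- w) (- \<zeta>) = (-1) ^ k * polar_pow N k w \<zeta>"
      by (cases k) (auto simp: polar_pow_def power_minus[of w] algebra_simps
            add_divide_distrib diff_divide_distrib)
    moreover have "(-1) ^ k * (-1) ^ k = (1::complex)"
      by (simp flip: power_mult_distrib)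
    moreover have "(-1) ^ k * c k * ((-1) ^ k * polar_pow N k w \<zeta>)
        = ((-1) ^ k * (-1) ^ k) * (c k * polar_pow N k w \<zeta>)"
      by (simp only: mult_ac)
    ultimately show ?thesis
      by simp
  qed
  ultimately show ?thesis
    by simp
qed

section \<open>Bilinear polynomials\<close>

text \<open>Solved for \<open>z\<close>, the zero set is
  \<open>z = - (a + b * y) / (c + d * y)\<close>. A pole in the upper half-plane would let
  \<open>z\<close> reach the lower half-plane from nearby values of \<open>y\<close>.\<close>

lemma bilinear_slope_nonzero:
  fixes a b c d :: complex
  assumes nz: "\<And>y z. Im y > 0 \<Longrightarrow> Im z < 0 \<Longrightarrow> a + b * y + c * z + d * y * z \<noteq> 0"
    and "d \<noteq> 0" "Im y\<^sub>0 > 0"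
  shows "c + d * y\<^sub>0 \<noteq> 0"
proof
  assume c0: "c + d * y\<^sub>0 = 0"
  define e where "e = a + b * y\<^sub>0"
  have e0: "e \<noteq> 0"
  proof -
    have "a + b * y\<^sub>0 + c * (-\<i>) + d * y\<^sub>0 * (-\<i>) = e - \<i> * (c + d * y\<^sub>0)"
      by (simp add: e_def algebra_simps)
    then show ?thesis
      using nz[of "y\<^sub>0" "-\<i>"] assms(3) c0 by simp
  qed
  text \<open>Near \<open>y\<^sub>0\<close> the root \<open>z\<close> tends to infinity in every direction as \<open>y\<close> turns around \<open>y\<^sub>0\<close>.\<close>
  define M where "M = max (\<bar>Im (b / d)\<bar> + 1) (2 * cmod (e / d) / Im y\<^sub>0)"
  have M: "M > 0" "M > \<bar>Im (b / d)\<bar>" "cmod (e / d) / M < Im y\<^sub>0"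
  proof -
    show "M > 0" "M > \<bar>Im (b / d)\<bar>"
      by (auto simp: M_def max_def)
    have "2 * cmod (e / d) / Im y\<^sub>0 \<le> M"
      by (simp add: M_def)
    then have "2 * cmod (e / d) \<le> M * Im y\<^sub>0"
      using assms(3) by (simp add: field_simps)
    moreover have "cmod (e / d) > 0"
      using e0 assms(2) by simp
    ultimately have "cmod (e / d) < M * Im y\<^sub>0"
      by linarith
    then show "cmod (e / d) / M < Im y\<^sub>0"
      using \<open>M > 0\<close> by (simp add: field_simps)
  qed
  \<comment> \<open>Since \<open>c + d * y\<^sub>0 = 0\<close>, the polynomial at
    \<open>(y\<^sub>0 + h, z)\<close> collapses to \<open>e - d * h * (\<i> * of_real M)\<close>,
    and \<open>h\<close> makes this zero. The bounds on \<open>M\<close> keep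
    \<open>y\<^sub>0 + h\<close> above and \<open>z\<close> below the real axis.\<close>
  define h where "h = e / d / (\<i> * of_real M)"
  define z where "z = - \<i> * of_real M - b / d"
  have "\<bar>Im h\<bar> \<le> cmod h"
    by (rule abs_Im_le_cmod)
  also have "cmod h = cmod (e / d) / M"
    using M by (simp add: h_def norm_divide norm_mult)
  finally have "Im (y\<^sub>0 + h) > 0"
    using M by simp
  moreover have "Im z < 0"
    using M by (auto simp: z_def)
  moreover have "a + b * (y\<^sub>0 + h) + c * z + d * (y\<^sub>0 + h) * z = 0"
  proof -
    have "d * h * (\<i> * of_real M) = e"
      using assms(2) M by (simp add: h_def)
    moreover have "d * (b / d) = b"
      using assms(2) by simp
    moreover have "a + b * (y\<^sub>0 + h) + c * z + d * (y\<^sub>0 + h) * z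
        = (c + d * y\<^sub>0) * z + e + b * h - d * h * (\<i> * of_real M) - d * (b / d) * h"
      by (simp add: z_def e_def algebra_simps)
    ultimately show ?thesis
      using c0 by simp
  qed
  ultimately show False
    using nz by blast
qed

text \<open>With the pole \<open>r = - c / d\<close> one has \<open>c + d * y = d * (y - r)\<close>,
  so adding \<open>d\<close> amounts to shifting \<open>z\<close> by \<open>1 / (y - r)\<close>. As
  \<open>Im r \<le> 0 < Im y\<close>, this shift points into the lower half-plane.\<close>

lemma bilinear_contraction_nonzero:
  fixes a b c d :: complex
  assumes nz: "\<And>y z. Im y > 0 \<Longrightarrow> Im z < 0 \<Longrightarrow> a + b * y + c * z + d * y * z \<noteq> 0"
    and "Im y > 0" "Im z < 0"
  shows "a + b * y + c * z + d * y * z + d \<noteq> 0"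
proof (cases "d = 0")
  case True
  then show ?thesis
    using nz[OF assms(2,3)] by simp
next
  case False
  define r where "r = - c / d"
  have "c + d * r = 0"
    using False by (simp add: r_def)
  then have "Im r \<le> 0"
    using bilinear_slope_nonzero[OF nz False, of r] by force
  then have im: "Im (y - r) > 0"
    using assms(2) by simp
  then have yr: "y - r \<noteq> 0"
    by auto
  have slope: "c + d * y = d * (y - r)"
    using \<open>c + d * r = 0\<close> by (simp add: algebra_simps add_eq_0_iff)
  have "Im (1 / (y - r)) < 0"
    using im yr by (simp add: Im_divide field_simps sum_power2_gt_zero_iff)
  then have "a + b * y + c * (z + 1 / (y - r)) + d * y * (z + 1 / (y - r)) \<noteq> 0"
    using assms by (intro nz) auto
  moreover have "a + b * y + c * (z + 1 / (y - r)) + d * y * (z + 1 / (y - r))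
      = a + b * y + c * z + d * y * z + (c + d * y) / (y - r)"
    by (simp add: algebra_simps add_divide_distrib)
  ultimately show ?thesis
    using yr by (simp add: slope)
qed

text \<open>If \<open>b * c > a * d\<close>, then at \<open>y = \<i>\<close> the limiting polynomial
  has its root \<open>z0\<close> in the open lower half-plane, and the roots of the approximating
  polynomials converge to it. Nonvanishing is asked of complex approximations because the
  contraction steps are perturbed by an imaginary amount.\<close>

lemma limit_bilinear_coefficients:
  fixes a b c d :: real and a' b' c' d' :: "nat \<Rightarrow> complex"
  assumes nz: "\<And>n y z. Im y > 0 \<Longrightarrow> Im z < 0 \<Longrightarrow> a' n + b' n * y + c' n * z + d' n * y * z \<noteq> 0"
    and lim: "a' \<longlonglongrightarrow> of_real a" "b' \<longlonglongrightarrow> of_real b" "c' \<longlonglongrightarrow> of_real c" "d' \<longlonglongrightarrow> of_real d"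
    and nonneg: "0 \<le> a" "0 \<le> b" "0 \<le> c" "0 \<le> d"
  shows "b * c \<le> a * d"
proof (rule ccontr)
  assume "\<not> b * c \<le> a * d"
  then have less: "a * d < b * c"
    by simp
  have "c \<noteq> 0"
    using less mult_nonneg_nonneg[OF nonneg(1,4)] by auto
  then have cd: "of_real c + of_real d * \<i> \<noteq> (0::complex)"
    by (auto simp: complex_eq_iff)
  define z where "z n = - (a' n + b' n * \<i>) / (c' n + d' n * \<i>)" for n
  define z0 :: complex where "z0 = - (of_real a + of_real b * \<i>) / (of_real c + of_real d * \<i>)"
  have "Im z0 = (a * d - b * c) / (c\<^sup>2 + d\<^sup>2)"
    by (simp add: z0_def Im_divide)
  then have im: "Im z0 < 0"
    using less \<open>c \<noteq> 0\<close> by (simp add: divide_less_0_iff sum_power2_gt_zero_iff)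
  have zlim: "z \<longlonglongrightarrow> z0"
    unfolding z_def[abs_def] z0_def by (intro tendsto_intros lim cd)
  have "(\<lambda>n. Im (z n)) \<longlonglongrightarrow> Im z0"
    by (intro tendsto_intros zlim)
  then have "\<forall>\<^sub>F n in sequentially. Im (z n) < 0"
    using im by (rule order_tendstoD)
  moreover have "(\<lambda>n. c' n + d' n * \<i>) \<longlonglongrightarrow> of_real c + of_real d * \<i>"
    by (intro tendsto_intros lim)
  then have "\<forall>\<^sub>F n in sequentially. c' n + d' n * \<i> \<noteq> 0"
    using cd by (rule tendsto_imp_eventually_ne)
  ultimately have "\<forall>\<^sub>F n in sequentially. False"
  proof eventually_elim
    case (elim n)
    have "a' n + b' n * \<i> + c' n * z n + d' n * \<i> * z n = a' n + b' n * \<i> + (c' n + d' n * \<i>) * z n"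
      by (simp add: algebra_simps)
    also have "\<dots> = 0"
      using elim(2) by (simp add: z_def)
    finally show False
      using nz[of \<i> "z n" n] elim(1) by simp
  qed
  then show False
    by simp
qed

section \<open>Capacity of a bilinear polynomial\<close>

definition self_powr :: "real \<Rightarrow> real" where
  "self_powr s = (if s = 0 then 1 else s powr s)"

text \<open>The logarithm is minus the binary entropy of \<open>s\<close>. For
  \<open>0 \<le> s \<le> 1\<close> the reciprocal is the infimum of
  \<open>(1 + w) / w powr s\<close> over \<open>w > 0\<close>.\<close>

definition entropy_factor :: "real \<Rightarrow> real" where
  "entropy_factor s = self_powr s * self_powr (1 - s)"

lemma self_powr_pos: "0 \<le> s \<Longrightarrow> 0 < self_powr s"
  by (simp add: self_powr_def)

lemma entropy_factor_pos: "0 \<le> s \<Longrightarrow> s \<le> 1 \<Longrightarrow> 0 < entropy_factor s"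
  unfolding entropy_factor_def by (intro mult_pos_pos self_powr_pos) auto

text \<open>On the hyperbola \<open>y * z = w\<close> the infimum of \<open>b * y + c * z\<close> is
  \<open>2 * sqrt (b * c * w)\<close>, which is at most
  \<open>2 * sqrt ((a * w) * d) \<le> a * w + d\<close>. The slack \<open>\<eta>\<close> handles
  \<open>b = 0\<close> or \<open>c = 0\<close>, where the infimum may be approached only at the end
  of a branch.\<close>

lemma hyperbola_near_minimum:
  fixes a b c d w \<eta> :: real
  assumes nonneg: "0 \<le> a" "0 \<le> b" "0 \<le> c" "0 \<le> d" and le: "b * c \<le> a * d"
    and "0 < w" "0 < \<eta>"
  shows "\<exists>y>0. \<exists>z>0. y * z = w \<and> b * y + c * z \<le> a * w + d + \<eta>"
proof -
  have aux: "0 \<le> a * w + d"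
    using assms by simp
  consider "b = 0" | "c = 0" | "b > 0" "c > 0"
    using nonneg by linarith
  then show ?thesis
  proof cases
    case 1
    define z where "z = \<eta> / (c + 1)"
    have "z > 0"
      using assms by (simp add: z_def add_nonneg_pos)
    moreover have "c * z \<le> \<eta>"
      using assms by (simp add: z_def divide_simps mult.commute mult_left_mono)
    ultimately have "0 < w / z" "0 < z" "(w / z) * (z) = w" "b * (w / z) + c * (z) \<le> a * w + d + \<eta>"
      using assms aux 1 by (auto intro: add_increasing)
    then show ?thesis
      by blast
  next
    case 2
    define y where "y = \<eta> / (b + 1)"
    have "y > 0"
      using assms by (simp add: y_def add_nonneg_pos)
    moreover have "b * y \<le> \<eta>"
      using assms by (simp add: y_def divide_simps mult.commute mult_left_mono)
    ultimately have "0 < y" "0 < w / y" "y * (w / y) = w" "b * (y) + c * (w / y) \<le> a * w + d + \<eta>"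
      using assms aux 2 by (auto intro: add_increasing)
    then show ?thesis
      by blast
  next
    case 3
    \<comment> \<open>The minimizer: it balances \<open>b * y\<close> and \<open>c * z\<close>, both
      equal to \<open>sqrt (b * c * w)\<close>.\<close>
    define y z where "y = sqrt (c * w / b)" and "z = sqrt (b * w / c)"
    have yz: "y > 0" "z > 0"
      using 3 assms by (auto simp: y_def z_def)
    have "y * z = sqrt ((c * w / b) * (b * w / c))"
      by (simp only: y_def z_def real_sqrt_mult)
    also have "(c * w / b) * (b * w / c) = w\<^sup>2"
      using 3 by (simp add: power2_eq_square)
    finally have prod: "y * z = w"
      using assms by simp
    have sq: "y\<^sup>2 = c * w / b" "z\<^sup>2 = b * w / c"
      using 3 assms by (auto simp: y_def z_def)
    have "(b * y)\<^sup>2 = b * c * w"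
      unfolding power_mult_distrib sq using 3 by (simp add: power2_eq_square)
    then have "sqrt (b * c * w) = b * y"
      using 3 yz by (intro real_sqrt_unique) auto
    moreover have "(c * z)\<^sup>2 = b * c * w"
      unfolding power_mult_distrib sq using 3 by (simp add: power2_eq_square)
    then have "sqrt (b * c * w) = c * z"
      using 3 yz by (intro real_sqrt_unique) auto
    ultimately have "b * y + c * z = 2 * sqrt (b * c * w)"
      by simp
    also have "b * c * w \<le> (a * w) * d"
      using mult_right_mono[OF le less_imp_le[OF \<open>0 < w\<close>]] by (simp add: mult_ac)
    then have "2 * sqrt (b * c * w) \<le> 2 * sqrt ((a * w) * d)"
      by simp
    also have "\<dots> \<le> a * w + d"
      using arith_geo_mean_sqrt[of "a * w" d] assms by simp
    finally have "b * y + c * z \<le> a * w + d + \<eta>"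
      using assms by simp
    then show ?thesis
      using yz prod by blast
  qed
qed

text \<open>Choosing \<open>y\<close> and \<open>z\<close> almost optimally with
  \<open>y * z = w\<close> turns the bound into \<open>K * w powr s \<le> (a + d) * (1 + w)\<close>;
  then \<open>w\<close> is optimized. For \<open>s = 0\<close> and \<open>s = 1\<close> the optimum
  is the limit of small and of large \<open>w\<close>.\<close>

lemma bilinear_capacity:
  fixes a b c d K s :: real
  assumes nonneg: "0 \<le> a" "0 \<le> b" "0 \<le> c" "0 \<le> d" and le: "b * c \<le> a * d"
    and s: "0 \<le> s" "s \<le> 1"
    and bound: "\<And>y z. 0 < y \<Longrightarrow> 0 < z \<Longrightarrow> K * (y * z) powr s \<le> a + b * y + c * z + d * y * z"
  shows "K * entropy_factor s \<le> a + d"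
proof -
  have main: "K * w powr s \<le> (a + d) * (1 + w)" if w: "0 < w" for w
  proof (rule field_le_epsilon)
    fix \<eta> :: real assume "0 < \<eta>"
    then obtain y z where yz: "0 < y" "0 < z" "y * z = w" "b * y + c * z \<le> a * w + d + \<eta>"
      using hyperbola_near_minimum[OF nonneg le w, of \<eta>] by blast
    have "K * w powr s \<le> a + b * y + c * z + d * (y * z)"
      using bound[OF yz(1,2)] by (simp add: yz(3) mult.assoc)
    also have "\<dots> \<le> (a + d) * (1 + w) + \<eta>"
      using yz(3,4) by (simp add: algebra_simps)
    finally show "K * w powr s \<le> (a + d) * (1 + w) + \<eta>" .
  qed
  consider "s = 0" | "s = 1" | "0 < s" "s < 1"
    using s by linarith
  then show ?thesis
  proof cases
    case 1
    have "K \<le> a + d"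
    proof (rule field_le_epsilon)
      fix \<eta> :: real assume \<eta>: "0 < \<eta>"
      define w where "w = \<eta> / (a + d + 1)"
      have "w > 0"
        using \<eta> nonneg by (simp add: w_def)
      moreover have "(a + d) * w \<le> \<eta>"
        using \<eta> nonneg by (simp add: w_def divide_simps)
      ultimately show "K \<le> a + d + \<eta>"
        using main[of w] 1 by (simp add: algebra_simps)
    qed
    then show ?thesis
      using 1 by (simp add: entropy_factor_def self_powr_def)
  next
    case 2
    have "K \<le> a + d"
    proof (rule field_le_epsilon)
      fix \<eta> :: real assume \<eta>: "0 < \<eta>"
      define w where "w = (a + d + 1) / \<eta>"
      have w: "w > 0"
        using \<eta> nonneg by (simp add: w_def)
      moreover have "(a + d) \<le> \<eta> * w"
        using \<eta> nonneg by (simp add: w_def divide_simps)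
      ultimately have "K * w \<le> (a + d + \<eta>) * w"
        using main[of w] 2 by (simp add: algebra_simps)
      then show "K \<le> a + d + \<eta>"
        using w by simp
    qed
    then show ?thesis
      using 2 by (simp add: entropy_factor_def self_powr_def)
  next
    case 3
    \<comment> \<open>The value \<open>w = s / (1 - s)\<close> minimizes
      \<open>(1 + w) / w powr s\<close>.\<close>
    have "K * (s / (1 - s)) powr s \<le> (a + d) * (1 + s / (1 - s))"
      using 3 by (intro main) simp
    also have "1 + s / (1 - s) = 1 / (1 - s)"
      using 3 by (simp add: field_simps)
    finally have "K * (s / (1 - s)) powr s * (1 - s) \<le> (a + d)"
      using 3 by (simp add: field_simps)
    also have "(s / (1 - s)) powr s = s powr s / (1 - s) powr s"
      using 3 by (simp add: powr_divide)
    finally have "K * (s powr s / (1 - s) powr s) * (1 - s) \<le> (a + d)" .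
    moreover have "(1 - s) powr (1 - s) = (1 - s) / (1 - s) powr s"
      using 3 by (simp add: powr_diff)
    ultimately show ?thesis
      using 3 by (simp add: entropy_factor_def self_powr_def)
  qed
qed

section \<open>The pairing in one pair of variables\<close>

text \<open>Arbitrary sequences stand in place of the powers of two variables, so that polarized
  powers and their coefficients can be substituted.\<close>

definition bilin_sum :: "nat \<Rightarrow> (nat \<Rightarrow> nat \<Rightarrow> 'a) \<Rightarrow> (nat \<Rightarrow> 'a) \<Rightarrow> (nat \<Rightarrow> 'a) \<Rightarrow> 'a::field_char_0" where
  "bilin_sum N A P Q = (\<Sum>j\<le>N. \<Sum>k\<le>N. A j k * P j * Q k)"

definition polar_const :: "nat \<Rightarrow> 'a::field_char_0 \<Rightarrow> nat \<Rightarrow> 'a" where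
  "polar_const N w j = (1 - of_nat j / of_nat N) * w ^ j"

definition polar_slope :: "nat \<Rightarrow> 'a::field_char_0 \<Rightarrow> nat \<Rightarrow> 'a" where
  "polar_slope N w j = of_nat j / of_nat N * w ^ (j - 1)"

lemma polar_pow_split: "polar_pow N j w \<zeta> = polar_const N w j + polar_slope N w j * \<zeta>"
  by (simp add: polar_pow_def polar_const_def polar_slope_def)

lemma bilin_sum_polar_pow:
  "bilin_sum N A (\<lambda>j. polar_pow N j y y') (\<lambda>k. polar_pow N k z z')
     = bilin_sum N A (polar_const N y) (polar_const N z)
       + bilin_sum N A (polar_slope N y) (polar_const N z) * y'
       + bilin_sum N A (polar_const N y) (polar_slope N z) * z'
       + bilin_sum N A (polar_slope N y) (polar_slope N z) * y' * z'"
proof -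
  have "A j k * polar_pow N j y y' * polar_pow N k z z'
      = A j k * polar_const N y j * polar_const N z k
        + A j k * polar_slope N y j * polar_const N z k * y'
        + A j k * polar_const N y j * polar_slope N z k * z'
        + A j k * polar_slope N y j * polar_slope N z k * y' * z'" for j k
    unfolding polar_pow_split by (simp add: algebra_simps)
  then show ?thesis
    by (simp add: bilin_sum_def sum.distrib sum_distrib_right)
qed

definition nonvanishing_upper_lower :: "nat \<Rightarrow> (nat \<Rightarrow> nat \<Rightarrow> complex) \<Rightarrow> bool" where
  "nonvanishing_upper_lower N A \<longleftrightarrow>
     (\<forall>y z. Im y > 0 \<longrightarrow> Im z < 0 \<longrightarrow> bilin_sum N A (\<lambda>j. y ^ j) (\<lambda>k. z ^ k) \<noteq> 0)"

text \<open>Laguerre's theorem is applied in the first variable with the second one fixed, and then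
  in the second variable with the first one already polarized.\<close>

lemma nonvanishing_polar_pow:
  assumes nv: "nonvanishing_upper_lower N A" and "N > 0"
    and "Im y > 0" "Im y' > 0" "Im z < 0" "Im z' < 0"
  shows "bilin_sum N A (\<lambda>j. polar_pow N j y y') (\<lambda>k. polar_pow N k z z') \<noteq> 0"
proof -
  have swap1: "bilin_sum N A P Q = (\<Sum>j\<le>N. (\<Sum>k\<le>N. A j k * Q k) * P j)" for P Q
    unfolding bilin_sum_def sum_distrib_right by (intro sum.cong refl) (simp only: mult_ac)
  have swap2: "bilin_sum N A P Q = (\<Sum>k\<le>N. (\<Sum>j\<le>N. A j k * P j) * Q k)" for P Q
    unfolding bilin_sum_def sum_distrib_right by (rule sum.swap)
  have "bilin_sum N A (\<lambda>j. polar_pow N j y y') (\<lambda>k. w ^ k) \<noteq> 0" if "Im w < 0" for w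
    using nv assms(2-4) that unfolding nonvanishing_upper_lower_def swap1
    by (intro polar_nonvanishing_upper) auto
  then show ?thesis
    using assms(2,5,6) unfolding swap2
    by (intro polar_nonvanishing_lower) auto
qed

text \<open>One polarization step in both variables, followed by \<open>a + b y' + c z' + d y' z' \<mapsto> a + d\<close>
  for \<open>e = 0\<close>. The perturbed functional is the value at \<open>(y', z') = (e, -e)\<close> plus \<open>d\<close>;
  for \<open>e = \<i> \<epsilon>\<close> it respects nonvanishing, so that no Hurwitz-type theorem is needed.\<close>

definition contract :: "'a::field_char_0 \<Rightarrow> nat \<Rightarrow> (nat \<Rightarrow> nat \<Rightarrow> 'a) \<Rightarrow> nat \<Rightarrow> nat \<Rightarrow> 'a" where
  "contract e M A j k =
     (let u = (\<lambda>j. 1 - of_nat j / of_nat (Suc M)); v = (\<lambda>j. of_nat j / of_nat (Suc M)) in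
       A j k * u j * u k
       + (1 - e\<^sup>2) * (A (Suc j) (Suc k) * v (Suc j) * v (Suc k))
       + e * (A (Suc j) k * v (Suc j) * u k)
       - e * (A j (Suc k) * u j * v (Suc k)))"

text \<open>The transpose of \<open>contract\<close>, acting on the array that is paired with the
  coefficients. The truncation of \<open>j - 1\<close> at \<open>j = 0\<close> is harmless because
  \<open>v 0 = 0\<close>.\<close>

definition cocontract :: "'a::field_char_0 \<Rightarrow> nat \<Rightarrow> (nat \<Rightarrow> nat \<Rightarrow> 'a) \<Rightarrow> nat \<Rightarrow> nat \<Rightarrow> 'a" where
  "cocontract e M X j k =
     (let u = (\<lambda>j. 1 - of_nat j / of_nat (Suc M)); v = (\<lambda>j. of_nat j / of_nat (Suc M)) in
       X j k * u j * u k
       + (1 - e\<^sup>2) * (X (j - 1) (k - 1) * v j * v k)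
       + e * (X (j - 1) k * v j * u k)
       - e * (X j (k - 1) * u j * v k))"

lemma sum_contract:
  "(\<Sum>j\<le>M. \<Sum>k\<le>M. contract e M A j k * X j k)
     = (\<Sum>j\<le>Suc M. \<Sum>k\<le>Suc M. A j k * cocontract e M X j k)"
proof -
  define u :: "nat \<Rightarrow> 'a" where "u = (\<lambda>j. 1 - of_nat j / of_nat (Suc M))"
  define v :: "nat \<Rightarrow> 'a" where "v = (\<lambda>j. of_nat j / of_nat (Suc M))"
  \<comment> \<open>These zeros make the index shifts exact: a factor \<open>u\<close> removes the
    index \<open>Suc M\<close>, a factor \<open>v\<close> removes the index 0.\<close>
  have uv: "u (Suc M) = 0" "v 0 = 0"
    using of_nat_neq_0[of M, where 'a = 'a] by (auto simp: u_def v_def)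
  have uu: "(\<Sum>j\<le>Suc M. \<Sum>k\<le>Suc M. F j k * u j * u k) = (\<Sum>j\<le>M. \<Sum>k\<le>M. F j k * u j * u k)" for F
    by (simp add: uv)
  have vu: "(\<Sum>j\<le>Suc M. \<Sum>k\<le>Suc M. F j k * v j * u k)
      = (\<Sum>j\<le>M. \<Sum>k\<le>M. F (Suc j) k * v (Suc j) * u k)" for F
    by (subst sum.atMost_Suc_shift) (simp add: uv)
  have uv': "(\<Sum>j\<le>Suc M. \<Sum>k\<le>Suc M. F j k * u j * v k)
      = (\<Sum>j\<le>M. \<Sum>k\<le>M. F j (Suc k) * u j * v (Suc k))" for F
    using vu[of "\<lambda>j k. F k j"]
    by (subst sum.swap, subst (2) sum.swap) (simp add: mult.commute mult.left_commute)
  have vv: "(\<Sum>j\<le>Suc M. \<Sum>k\<le>Suc M. F j k * v j * v k)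
      = (\<Sum>j\<le>M. \<Sum>k\<le>M. F (Suc j) (Suc k) * v (Suc j) * v (Suc k))" for F
    by (simp add: uv sum.atMost_Suc_shift del: sum.atMost_Suc)
  have "(\<Sum>j\<le>Suc M. \<Sum>k\<le>Suc M. A j k * cocontract e M X j k)
      = (\<Sum>j\<le>Suc M. \<Sum>k\<le>Suc M. (A j k * X j k) * u j * u k)
        + (1 - e\<^sup>2) * (\<Sum>j\<le>Suc M. \<Sum>k\<le>Suc M. (A j k * X (j - 1) (k - 1)) * v j * v k)
        + e * (\<Sum>j\<le>Suc M. \<Sum>k\<le>Suc M. (A j k * X (j - 1) k) * v j * u k)
        - e * (\<Sum>j\<le>Suc M. \<Sum>k\<le>Suc M. (A j k * X j (k - 1)) * u j * v k)"
    unfolding sum_distrib_left sum.distrib[symmetric] sum_subtractf[symmetric] cocontract_def Let_def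
      u_def[symmetric] v_def[symmetric]
    by (intro sum.cong refl) (simp add: algebra_simps)
  also have "\<dots> = (\<Sum>j\<le>M. \<Sum>k\<le>M. contract e M A j k * X j k)"
    unfolding uu vu uv' vv
    unfolding sum_distrib_left sum.distrib[symmetric] sum_subtractf[symmetric] contract_def Let_def
      u_def[symmetric] v_def[symmetric]
    by (intro sum.cong refl) (simp add: algebra_simps)
  finally show ?thesis
    by simp
qed

text \<open>The transpose splits each power in \<open>y ^ j * z ^ k\<close> into the two
  coefficients of its polarization. The result is the bilinear polynomial in the new variables at
  \<open>(e, - e)\<close>, plus its top coefficient.\<close>

lemma bilin_sum_contract_pow:
  "bilin_sum M (contract e M A) (\<lambda>j. y ^ j) (\<lambda>k. z ^ k)
     = bilin_sum (Suc M) A (polar_const (Suc M) y) (polar_const (Suc M) z)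
       + (1 - e\<^sup>2) * bilin_sum (Suc M) A (polar_slope (Suc M) y) (polar_slope (Suc M) z)
       + e * bilin_sum (Suc M) A (polar_slope (Suc M) y) (polar_const (Suc M) z)
       - e * bilin_sum (Suc M) A (polar_const (Suc M) y) (polar_slope (Suc M) z)"
proof -
  have "bilin_sum M (contract e M A) (\<lambda>j. y ^ j) (\<lambda>k. z ^ k)
      = (\<Sum>j\<le>Suc M. \<Sum>k\<le>Suc M. A j k * cocontract e M (\<lambda>j k. y ^ j * z ^ k) j k)"
    unfolding sum_contract[symmetric] bilin_sum_def by (simp add: mult.assoc)
  then show ?thesis
    unfolding bilin_sum_def sum_distrib_left sum.distrib[symmetric] sum_subtractf[symmetric]
      cocontract_def polar_const_def polar_slope_def Let_def
    by (simp only:) (intro sum.cong refl, simp only: algebra_simps)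
qed

lemma nonvanishing_contract:
  assumes nv: "nonvanishing_upper_lower (Suc M) A" and "\<epsilon> > 0"
  shows "nonvanishing_upper_lower M (contract (\<i> * of_real \<epsilon>) M A)"
  unfolding nonvanishing_upper_lower_def
proof (intro allI impI)
  fix y z :: complex
  assume yz: "Im y > 0" "Im z < 0"
  define a b c d where "a = bilin_sum (Suc M) A (polar_const (Suc M) y) (polar_const (Suc M) z)"
    and "b = bilin_sum (Suc M) A (polar_slope (Suc M) y) (polar_const (Suc M) z)"
    and "c = bilin_sum (Suc M) A (polar_const (Suc M) y) (polar_slope (Suc M) z)"
    and "d = bilin_sum (Suc M) A (polar_slope (Suc M) y) (polar_slope (Suc M) z)"
  have "a + b * y' + c * z' + d * y' * z' \<noteq> 0" if "Im y' > 0" "Im z' < 0" for y' z'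
    using nonvanishing_polar_pow[OF nv _ yz(1) that(1) yz(2) that(2)]
    by (simp add: bilin_sum_polar_pow a_def b_def c_def d_def)
  \<comment> \<open>For positive \<open>\<epsilon>\<close> the point with coordinates
    \<open>\<i> * of_real \<epsilon>\<close> and its negative lies in the open product of
    half-planes, whereas \<open>e = 0\<close> would lie on its boundary.\<close>
  then have "a + b * (\<i> * of_real \<epsilon>) + c * (- (\<i> * of_real \<epsilon>))
      + d * (\<i> * of_real \<epsilon>) * (- (\<i> * of_real \<epsilon>)) + d \<noteq> 0"
    using \<open>\<epsilon> > 0\<close> by (intro bilinear_contraction_nonzero) auto
  then show "bilin_sum M (contract (\<i> * of_real \<epsilon>) M A) (\<lambda>j. y ^ j) (\<lambda>k. z ^ k) \<noteq> 0"
    unfolding bilin_sum_contract_pow a_def[symmetric] b_def[symmetric] c_def[symmetric] d_def[symmetric]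
    by (simp add: algebra_simps power2_eq_square)
qed

text \<open>All \<open>N\<close> contractions transposed at once: summing a coefficient array
  against this matrix gives the constant that remains after contracting down to degree 0.\<close>

primrec pairing_matrix :: "'a::field_char_0 \<Rightarrow> nat \<Rightarrow> nat \<Rightarrow> nat \<Rightarrow> 'a" where
  "pairing_matrix e 0 = (\<lambda>j k. 1)"
| "pairing_matrix e (Suc M) = cocontract e M (pairing_matrix e M)"

text \<open>Each contraction preserves nonvanishing, and in degree 0 nonvanishing says that the
  remaining constant is nonzero.\<close>

lemma pairing_nonzero:
  assumes "nonvanishing_upper_lower N A" "\<epsilon> > 0"
  shows "(\<Sum>j\<le>N. \<Sum>k\<le>N. A j k * pairing_matrix (\<i> * of_real \<epsilon>) N j k) \<noteq> 0"
  using assms(1)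
proof (induction N arbitrary: A)
  case 0
  then have "bilin_sum 0 A (\<lambda>j. \<i> ^ j) (\<lambda>k. (- \<i>) ^ k) \<noteq> 0"
    unfolding nonvanishing_upper_lower_def by simp
  then show ?case
    by (simp add: bilin_sum_def)
next
  case (Suc M)
  show ?case
    unfolding pairing_matrix.simps sum_contract[symmetric]
    using Suc.IH[OF nonvanishing_contract[OF Suc.prems \<open>\<epsilon> > 0\<close>]] .
qed

text \<open>With \<open>n = Suc M\<close>, absorption identities turn
  \<open>(1 - j / n)\<^sup>2 / (M choose j)\<close> and
  \<open>(j / n)\<^sup>2 / (M choose (j - 1))\<close> into \<open>(1 - j / n) / (n choose j)\<close>
  and \<open>(j / n) / (n choose j)\<close>, whose sum is \<open>1 / (n choose j)\<close>.\<close>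

lemma pairing_matrix_0:
  assumes "j \<le> N" "k \<le> N"
  shows "pairing_matrix 0 N j k = (if j = k then 1 / of_nat (N choose j) else (0 :: 'a :: field_char_0))"
  using assms
proof (induction N arbitrary: j k)
  case (Suc M)
  define n :: 'a where "n = of_nat (Suc M)"
  have n: "n \<noteq> 0"
    unfolding n_def by (rule of_nat_neq_0)
  have expand: "pairing_matrix 0 (Suc M) j k = pairing_matrix 0 M j k * (1 - of_nat j / n) * (1 - of_nat k / n)
      + pairing_matrix 0 M (j - 1) (k - 1) * (of_nat j / n) * (of_nat k / n)"
    by (simp add: cocontract_def Let_def n_def)
  \<comment> \<open>An index equal to \<open>Suc M\<close> is outside the range of the induction
    hypothesis, but there a factor \<open>1 - of_nat j / n\<close> or
    \<open>1 - of_nat k / n\<close> is zero.\<close>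
  have first: "pairing_matrix 0 M j k * (1 - of_nat j / n) * (1 - of_nat k / n)
      = (if j = k then (1 - of_nat j / n) / of_nat (Suc M choose j) else 0)"
  proof (cases "j = Suc M \<or> k = Suc M")
    case True
    then show ?thesis
      using n by (auto simp: n_def)
  next
    case False
    then have le: "j \<le> M" "k \<le> M"
      using Suc.prems by auto
    have "(of_nat (Suc M) - of_nat j) * of_nat (Suc M choose j) = (of_nat (Suc M) * of_nat (M choose j) :: 'a)"
      using binomial_absorb_comp[of "Suc M" j] le
      by (metis Suc.prems(1) diff_Suc_1 of_nat_diff of_nat_mult)
    then have "(n - of_nat j) * of_nat (Suc M choose j) = n * (of_nat (M choose j) :: 'a)"
      by (simp only: n_def)
    then have eq: "(1 - of_nat j / n) * of_nat (Suc M choose j) = (of_nat (M choose j) :: 'a)"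
      using n by (simp add: field_simps del: binomial_Suc_Suc)
    have nz: "(of_nat (M choose j) :: 'a) \<noteq> 0" "(of_nat (Suc M choose j) :: 'a) \<noteq> 0"
      using le Suc.prems by (simp_all add: binomial_eq_0_iff del: binomial_Suc_Suc)
    then have "1 / of_nat (M choose j) * (1 - of_nat j / n) = 1 / (of_nat (Suc M choose j) :: 'a)"
      by (simp add: field_simps flip: eq)
    then have "1 / of_nat (M choose j) * (1 - of_nat j / n) * (1 - of_nat j / n)
        = (1 - of_nat j / n) / (of_nat (Suc M choose j) :: 'a)"
      by simp
    then show ?thesis
      unfolding Suc.IH[OF le] by auto
  qed
  have second: "pairing_matrix 0 M (j - 1) (k - 1) * (of_nat j / n) * (of_nat k / n)
      = (if j = k then (of_nat j / n) / of_nat (Suc M choose j) else 0)"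
  proof (cases "j = 0 \<or> k = 0")
    case True
    then show ?thesis
      by auto
  next
    case False
    then obtain i l where il: "j = Suc i" "k = Suc l"
      by (meson not0_implies_Suc)
    then have le: "i \<le> M" "l \<le> M"
      using Suc.prems by auto
    have "of_nat (Suc i) * of_nat (Suc M choose Suc i) = (of_nat (Suc M) * of_nat (M choose i) :: 'a)"
      using Suc_times_binomial_eq[of M i] by (metis mult.commute of_nat_mult)
    then have eq: "of_nat j / n * of_nat (Suc M choose j) = (of_nat (M choose i) :: 'a)"
      using n unfolding il n_def[symmetric] by (simp add: divide_simps mult.commute)
    have nz: "(of_nat (M choose i) :: 'a) \<noteq> 0" "(of_nat (Suc M choose j) :: 'a) \<noteq> 0"
      using le Suc.prems by (simp_all add: binomial_eq_0_iff del: binomial_Suc_Suc)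
    have "of_nat j / n = of_nat (M choose i) / (of_nat (Suc M choose j) :: 'a)"
      using eq nz(2) by (metis nonzero_mult_div_cancel_right)
    then have "1 / of_nat (M choose i) * (of_nat j / n) = 1 / (of_nat (Suc M choose j) :: 'a)"
      using nz(1) by simp
    then have "1 / of_nat (M choose i) * (of_nat j / n) * (of_nat j / n)
        = (of_nat j / n) / (of_nat (Suc M choose j) :: 'a)"
      by simp
    then show ?thesis
      using il by (auto simp: Suc.IH[OF le] mult.assoc simp del: binomial_Suc_Suc of_nat_Suc)
  qed
  show ?case
    unfolding expand first second by (simp add: diff_divide_distrib)
qed simp

lemma pairing_matrix_tendsto:
  assumes "(e \<longlongrightarrow> 0) F"
  shows "((\<lambda>x. pairing_matrix (e x) N j k) \<longlongrightarrow> complex_of_real (pairing_matrix 0 N j k)) F"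
proof (induction N arbitrary: j k)
  case (Suc N)
  have "((\<lambda>x. cocontract (e x) N (pairing_matrix (e x) N) j k) \<longlongrightarrow>
      cocontract 0 N (\<lambda>j k. complex_of_real (pairing_matrix 0 N j k)) j k) F"
    unfolding cocontract_def Let_def by (intro tendsto_intros Suc.IH assms)
  then show ?case
    by (simp add: cocontract_def Let_def)
qed simp

text \<open>Weighted AM-GM for \<open>y ^ j\<close> and \<open>y ^ (j - 1) * \<zeta>\<close> with
  weights \<open>1 - j / N\<close> and \<open>j / N\<close>. The base on the left is the geometric
  mean of \<open>N - 1\<close> copies of \<open>y\<close> and one \<open>\<zeta>\<close>.\<close>

lemma power_le_polar_pow:
  fixes y \<zeta> :: real
  assumes "y > 0" "\<zeta> > 0" "j \<le> N" "N > 0"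
  shows "(y powr (1 - 1 / N) * \<zeta> powr (1 / N)) ^ j \<le> polar_pow N j y \<zeta>"
proof (cases j)
  case 0
  then show ?thesis
    by (simp add: polar_pow_def)
next
  case (Suc i)
  define \<theta> where "\<theta> = real j / real N"
  have \<theta>: "0 \<le> \<theta>" "\<theta> \<le> 1"
    using assms by (auto simp: \<theta>_def)
  have "(y powr (1 - 1 / N) * \<zeta> powr (1 / N)) ^ j = y powr (j - \<theta>) * \<zeta> powr \<theta>"
    using assms by (simp add: power_mult_distrib powr_power \<theta>_def algebra_simps)
  also have "y powr (j - \<theta>) = (y powr j) powr (1 - \<theta>) * (y powr i) powr \<theta>"
    unfolding powr_powr powr_add[symmetric] by (simp add: Suc algebra_simps)
  also have "\<dots> * \<zeta> powr \<theta> = (y ^ j) powr (1 - \<theta>) * (y ^ i * \<zeta>) powr \<theta>"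
    using assms by (simp add: powr_realpow powr_mult)
  also have "\<dots> \<le> (1 - \<theta>) * y ^ j + \<theta> * (y ^ i * \<zeta>)"
    using assms \<theta> by (intro Youngs_inequality_0) auto
  also have "\<dots> = polar_pow N j y \<zeta>"
    by (simp add: polar_pow_def \<theta>_def Suc)
  finally show ?thesis .
qed

text \<open>Induction on the degree, one contraction and one factor \<open>entropy_factor s\<close>
  per step. The limit array \<open>A\<close> carries the inequalities, while the approximations
  \<open>A' n\<close> carry nonvanishing, which could be lost in the limit.\<close>

lemma pairing_capacity:
  fixes A :: "nat \<Rightarrow> nat \<Rightarrow> real" and A' :: "nat \<Rightarrow> nat \<Rightarrow> nat \<Rightarrow> complex"
    and \<epsilon> :: "nat \<Rightarrow> real"
  assumes s: "0 \<le> s" "s \<le> 1"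
    and \<epsilon>: "\<And>n. 0 < \<epsilon> n" "\<epsilon> \<longlonglongrightarrow> 0"
    and nonneg: "\<And>j k. j \<le> N \<Longrightarrow> k \<le> N \<Longrightarrow> 0 \<le> A j k"
    and lim: "\<And>j k. (\<lambda>n. A' n j k) \<longlonglongrightarrow> of_real (A j k)"
    and nv: "\<And>n. nonvanishing_upper_lower N (A' n)"
    and bound: "\<And>y z. 0 < y \<Longrightarrow> 0 < z \<Longrightarrow>
        K * (y * z) powr (s * N) \<le> bilin_sum N A (\<lambda>j. y ^ j) (\<lambda>k. z ^ k)"
  shows "K * entropy_factor s ^ N \<le> (\<Sum>j\<le>N. \<Sum>k\<le>N. A j k * pairing_matrix 0 N j k)"
  using nonneg lim nv bound
proof (induction N arbitrary: A A' K)
  case 0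
  then show ?case
    using "0.prems"(4)[of 1 1] by (simp add: bilin_sum_def)
next
  case (Suc M)
  let ?N = "Suc M"
  have "K * entropy_factor s * entropy_factor s ^ M
      \<le> (\<Sum>j\<le>M. \<Sum>k\<le>M. contract 0 M A j k * pairing_matrix 0 M j k)"
  proof (rule Suc.IH)
    show "0 \<le> contract 0 M A j k" if "j \<le> M" "k \<le> M" for j k
      using Suc.prems(1) that by (auto simp: contract_def Let_def divide_simps)
    show "nonvanishing_upper_lower M (contract (\<i> * of_real (\<epsilon> n)) M (A' n))" for n
      using nonvanishing_contract[OF Suc.prems(3) \<epsilon>(1)] .
    show "(\<lambda>n. contract (\<i> * of_real (\<epsilon> n)) M (A' n) j k) \<longlonglongrightarrow> of_real (contract 0 M A j k)" for j k
    proof -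
      have "(\<lambda>n. contract (\<i> * of_real (\<epsilon> n)) M (A' n) j k)
          \<longlonglongrightarrow> contract (\<i> * of_real 0) M (\<lambda>j k. of_real (A j k)) j k"
        unfolding contract_def Let_def
        by (intro tendsto_add tendsto_diff tendsto_mult tendsto_power tendsto_const tendsto_of_real
            Suc.prems(2) \<epsilon>(2))
      then show ?thesis
        by (simp add: contract_def Let_def)
    qed
    fix y z :: real
    assume yz: "0 < y" "0 < z"
    define a b c d where "a = bilin_sum ?N A (polar_const ?N y) (polar_const ?N z)"
      and "b = bilin_sum ?N A (polar_slope ?N y) (polar_const ?N z)"
      and "c = bilin_sum ?N A (polar_const ?N y) (polar_slope ?N z)"
      and "d = bilin_sum ?N A (polar_slope ?N y) (polar_slope ?N z)"
    have pos: "0 \<le> polar_const ?N w j" "0 \<le> polar_slope ?N w j" if "0 < w" "j \<le> ?N" for w :: real and j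
      using that by (auto simp: polar_const_def polar_slope_def divide_simps)
    have abcd: "0 \<le> a" "0 \<le> b" "0 \<le> c" "0 \<le> d"
      unfolding a_def b_def c_def d_def bilin_sum_def
      using Suc.prems(1) pos yz
      by (auto intro!: sum_nonneg mult_nonneg_nonneg simp del: sum.atMost_Suc)
    \<comment> \<open>The real points are pushed into the half-planes, where nonvanishing of
      \<open>A' n\<close> applies, and return to \<open>y\<close> and \<open>z\<close> in the
      limit.\<close>
    define y' z' where "y' n = of_real y + \<i> * of_real (\<epsilon> n)" and "z' n = of_real z - \<i> * of_real (\<epsilon> n)" for n
    have "y' \<longlonglongrightarrow> of_real y + \<i> * of_real 0" "z' \<longlonglongrightarrow> of_real z - \<i> * of_real 0"
      unfolding y'_def z'_def by (intro tendsto_intros \<epsilon>(2))+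
    then have y'z': "y' \<longlonglongrightarrow> of_real y" "z' \<longlonglongrightarrow> of_real z"
      by simp_all
    have polar_lim: "(\<lambda>n. polar_const ?N (w' n) j) \<longlonglongrightarrow> complex_of_real (polar_const ?N w j)"
       "(\<lambda>n. polar_slope ?N (w' n) j) \<longlonglongrightarrow> complex_of_real (polar_slope ?N w j)"
      if "w' \<longlonglongrightarrow> of_real w" for w w' j
    proof -
      have "(\<lambda>n. polar_const ?N (w' n) j) \<longlonglongrightarrow> polar_const ?N (of_real w) j"
        "(\<lambda>n. polar_slope ?N (w' n) j) \<longlonglongrightarrow> polar_slope ?N (of_real w) j"
        unfolding polar_const_def polar_slope_def by (intro tendsto_intros that)+
      then show "(\<lambda>n. polar_const ?N (w' n) j) \<longlonglongrightarrow> complex_of_real (polar_const ?N w j)"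
       "(\<lambda>n. polar_slope ?N (w' n) j) \<longlonglongrightarrow> complex_of_real (polar_slope ?N w j)"
        by (simp_all add: polar_const_def polar_slope_def)
    qed
    have sum_lim: "(\<lambda>n. bilin_sum ?N (A' n) (P' n) (Q' n)) \<longlonglongrightarrow> complex_of_real (bilin_sum ?N A P Q)"
      if "\<And>j. (\<lambda>n. P' n j) \<longlonglongrightarrow> of_real (P j)" "\<And>j. (\<lambda>n. Q' n j) \<longlonglongrightarrow> of_real (Q j)" for P P' Q Q'
      unfolding bilin_sum_def of_real_sum of_real_mult
      by (intro tendsto_intros that Suc.prems(2))
    have "b * c \<le> a * d"
    proof (rule limit_bilinear_coefficients[OF _ _ _ _ _ abcd, where
          a' = "\<lambda>n. bilin_sum ?N (A' n) (polar_const ?N (y' n)) (polar_const ?N (z' n))" and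
          b' = "\<lambda>n. bilin_sum ?N (A' n) (polar_slope ?N (y' n)) (polar_const ?N (z' n))" and
          c' = "\<lambda>n. bilin_sum ?N (A' n) (polar_const ?N (y' n)) (polar_slope ?N (z' n))" and
          d' = "\<lambda>n. bilin_sum ?N (A' n) (polar_slope ?N (y' n)) (polar_slope ?N (z' n))"])
      show "bilin_sum ?N (A' n) (polar_const ?N (y' n)) (polar_const ?N (z' n))
          + bilin_sum ?N (A' n) (polar_slope ?N (y' n)) (polar_const ?N (z' n)) * v
          + bilin_sum ?N (A' n) (polar_const ?N (y' n)) (polar_slope ?N (z' n)) * w
          + bilin_sum ?N (A' n) (polar_slope ?N (y' n)) (polar_slope ?N (z' n)) * v * w \<noteq> 0"
        if "Im v > 0" "Im w < 0" for n v w
        unfolding bilin_sum_polar_pow[symmetric]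
        using that \<epsilon>(1) by (intro nonvanishing_polar_pow[OF Suc.prems(3)]) (auto simp: y'_def z'_def)
    qed (unfold a_def b_def c_def d_def, (intro sum_lim polar_lim y'z')+)
    \<comment> \<open>The capacity bound for bilinear polynomials is used in the new variables, with
      \<open>y\<close> and \<open>z\<close> frozen and \<open>K * (y * z) powr (s * M)\<close> in
      the role of the constant.\<close>
    then have "K * (y * z) powr (s * M) * entropy_factor s \<le> a + d"
    proof (rule bilinear_capacity[OF abcd _ s])
      fix v w :: real
      assume vw: "0 < v" "0 < w"
      \<comment> \<open>Weighted geometric means, chosen so that
        \<open>(g * h) powr (s * ?N)\<close> splits into \<open>(y * z) powr (s * M)\<close> and
        \<open>(v * w) powr s\<close>.\<close>
      define g h where "g = y powr (1 - 1 / ?N) * v powr (1 / ?N)" and "h = z powr (1 - 1 / ?N) * w powr (1 / ?N)"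
      have gh: "g > 0" "h > 0"
        using yz vw by (auto simp: g_def h_def)
      have exps: "(1 - 1 / ?N) * (s * ?N) = s * M" "(1 / ?N) * (s * ?N) = s"
        by (simp_all add: field_simps)
      have "g * h = (y * z) powr (1 - 1 / ?N) * (v * w) powr (1 / ?N)"
        using yz vw by (simp add: g_def h_def powr_mult)
      moreover have "(p powr t * q powr r) powr l = p powr (t * l) * q powr (r * l)"
        for p q t r l :: real
        by (simp add: powr_mult powr_powr)
      ultimately have "(g * h) powr (s * ?N) = (y * z) powr (s * M) * (v * w) powr s"
        by (simp only: exps)
      then have "K * (y * z) powr (s * M) * (v * w) powr s = K * (g * h) powr (s * ?N)"
        by simp
      also have "\<dots> \<le> bilin_sum ?N A (\<lambda>j. g ^ j) (\<lambda>k. h ^ k)"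
        using Suc.prems(4)[OF gh] .
      also have "\<dots> \<le> bilin_sum ?N A (\<lambda>j. polar_pow ?N j y v) (\<lambda>k. polar_pow ?N k z w)"
      proof -
        have g: "g ^ j \<le> polar_pow ?N j y v" "h ^ j \<le> polar_pow ?N j z w" if "j \<le> ?N" for j
          using power_le_polar_pow[OF yz(1) vw(1) that] power_le_polar_pow[OF yz(2) vw(2) that]
          by (simp_all add: g_def h_def)
        show ?thesis
          unfolding bilin_sum_def
        proof (intro sum_mono mult_mono)
          fix j k assume "j \<in> {..?N}" "k \<in> {..?N}"
          then have "0 \<le> polar_pow ?N j y v"
            using g(1)[of j] zero_less_power[OF gh(1), of j] by simp
          with \<open>j \<in> {..?N}\<close> \<open>k \<in> {..?N}\<close>
          show "0 \<le> A j k" "0 \<le> g ^ j" "0 \<le> h ^ k" "0 \<le> A j k * polar_pow ?N j y v"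
            using Suc.prems(1) gh by auto
        qed (use g in auto)
      qed
      also have "\<dots> = a + b * v + c * w + d * v * w"
        by (simp add: bilin_sum_polar_pow a_def b_def c_def d_def)
      finally show "K * (y * z) powr (s * M) * (v * w) powr s \<le> a + b * v + c * w + d * v * w" .
    qed
    then show "K * entropy_factor s * (y * z) powr (s * M)
        \<le> bilin_sum M (contract 0 M A) (\<lambda>j. y ^ j) (\<lambda>k. z ^ k)"
      by (simp add: bilin_sum_contract_pow a_def d_def mult_ac)
  qed
  then show ?case
    by (simp add: sum_contract mult.assoc del: sum.atMost_Suc)
qed

section \<open>The pairing in several variables\<close>

definition multi_sum :: "nat ^ 'n \<Rightarrow> (nat ^ 'n \<Rightarrow> 'a) \<Rightarrow> (nat ^ 'n \<Rightarrow> 'a)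
    \<Rightarrow> ('n \<Rightarrow> nat \<Rightarrow> nat \<Rightarrow> 'a) \<Rightarrow> 'a::field_char_0" where
  "multi_sum lam P Q W =
     (\<Sum>\<mu> | \<mu> \<le> lam. \<Sum>\<nu> | \<nu> \<le> lam. P \<mu> * Q \<nu> * (\<Prod>i\<in>UNIV. W i (\<mu> $ i) (\<nu> $ i)))"

definition slice_coeff :: "nat ^ 'n \<Rightarrow> (nat ^ 'n \<Rightarrow> 'a) \<Rightarrow> (nat ^ 'n \<Rightarrow> 'a)
    \<Rightarrow> ('n \<Rightarrow> nat \<Rightarrow> nat \<Rightarrow> 'a) \<Rightarrow> 'n \<Rightarrow> nat \<Rightarrow> nat \<Rightarrow> 'a::field_char_0" where
  "slice_coeff lam P Q W i j k =
     (\<Sum>\<mu> | \<mu> \<le> lam \<and> \<mu> $ i = j. \<Sum>\<nu> | \<nu> \<le> lam \<and> \<nu> $ i = k.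
        P \<mu> * Q \<nu> * (\<Prod>l\<in>-{i}. W l (\<mu> $ l) (\<nu> $ l)))"

lemma multi_sum_slice:
  fixes lam :: "nat ^ 'n::finite"
  shows "multi_sum lam P Q W = (\<Sum>j\<le>lam $ i. \<Sum>k\<le>lam $ i. slice_coeff lam P Q W i j k * W i j k)"
proof -
  have group: "(\<Sum>\<mu> | \<mu> \<le> lam. f \<mu>) = (\<Sum>j\<le>lam $ i. \<Sum>\<mu> | \<mu> \<le> lam \<and> \<mu> $ i = j. f \<mu>)"
    for f :: "nat ^ 'n \<Rightarrow> 'a"
    using sum.group[OF finite_vec_nat_atMost, of "{..lam $ i}" "\<lambda>\<mu>. \<mu> $ i" lam f]
    by (auto simp: less_eq_vec_def image_subset_iff)
  have "(\<Prod>l\<in>UNIV. W l (\<mu> $ l) (\<nu> $ l)) = W i (\<mu> $ i) (\<nu> $ i) * (\<Prod>l\<in>-{i}. W l (\<mu> $ l) (\<nu> $ l))"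
    for \<mu> \<nu> :: "nat ^ 'n"
    using prod.remove[of UNIV i] by (auto simp: Compl_eq_Diff_UNIV)
  then have "multi_sum lam P Q W = (\<Sum>\<mu> | \<mu> \<le> lam. \<Sum>\<nu> | \<nu> \<le> lam.
      P \<mu> * Q \<nu> * (\<Prod>l\<in>-{i}. W l (\<mu> $ l) (\<nu> $ l)) * W i (\<mu> $ i) (\<nu> $ i))"
    by (simp add: multi_sum_def mult_ac)
  also have "\<dots> = (\<Sum>j\<le>lam $ i. \<Sum>\<mu> | \<mu> \<le> lam \<and> \<mu> $ i = j. \<Sum>k\<le>lam $ i. \<Sum>\<nu> | \<nu> \<le> lam \<and> \<nu> $ i = k.
      P \<mu> * Q \<nu> * (\<Prod>l\<in>-{i}. W l (\<mu> $ l) (\<nu> $ l)) * W i j k)"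
    unfolding group by (intro sum.cong refl) auto
  also have "\<dots> = (\<Sum>j\<le>lam $ i. \<Sum>k\<le>lam $ i. slice_coeff lam P Q W i j k * W i j k)"
    unfolding slice_coeff_def sum_distrib_right by (intro sum.cong refl sum.swap)
  finally show ?thesis .
qed

text \<open>The product in \<open>slice_coeff\<close> omits the index \<open>i\<close>. Hence the
  array stays fixed while the variables of the \<open>i\<close>-th pair vary, and the results on one
  pair of variables apply to it.\<close>

lemma slice_coeff_cong:
  assumes "\<And>l. l \<noteq> i \<Longrightarrow> W l = W' l"
  shows "slice_coeff lam P Q W i = slice_coeff lam P Q W' i"
  using assms by (intro ext) (simp add: slice_coeff_def)

text \<open>Interpolates between evaluation and pairing: pairs of variables with index in
  \<open>I\<close> have been contracted completely, the others are still evaluated at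
  \<open>y\<close> and \<open>z\<close>.\<close>

definition mixed_weight ::
    "'a \<Rightarrow> nat ^ 'n \<Rightarrow> 'n set \<Rightarrow> ('n \<Rightarrow> 'a) \<Rightarrow> ('n \<Rightarrow> 'a) \<Rightarrow> 'n \<Rightarrow> nat \<Rightarrow> nat \<Rightarrow> 'a::field_char_0" where
  "mixed_weight e lam I y z i j k = (if i \<in> I then pairing_matrix e (lam $ i) j k else y i ^ j * z i ^ k)"

lemma bilin_sum_slice:
  fixes lam :: "nat ^ 'n::finite"
  assumes "i \<notin> I"
  shows "bilin_sum (lam $ i) (slice_coeff lam P Q (mixed_weight e lam I y z) i) (\<lambda>j. v ^ j) (\<lambda>k. w ^ k)
    = multi_sum lam P Q (mixed_weight e lam I (y(i := v)) (z(i := w)))"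
proof -
  have "slice_coeff lam P Q (mixed_weight e lam I y z) i
      = slice_coeff lam P Q (mixed_weight e lam I (y(i := v)) (z(i := w))) i"
    by (rule slice_coeff_cong) (simp add: mixed_weight_def fun_eq_iff)
  then show ?thesis
    using assms unfolding multi_sum_slice[of _ _ _ _ i] bilin_sum_def
    by (simp add: mixed_weight_def mult.assoc)
qed

lemma multi_sum_insert:
  fixes lam :: "nat ^ 'n::finite"
  shows "multi_sum lam P Q (mixed_weight e lam (insert i I) y z)
    = (\<Sum>j\<le>lam $ i. \<Sum>k\<le>lam $ i.
        slice_coeff lam P Q (mixed_weight e lam I y z) i j k * pairing_matrix e (lam $ i) j k)"
proof -
  have "slice_coeff lam P Q (mixed_weight e lam (insert i I) y z) i
      = slice_coeff lam P Q (mixed_weight e lam I y z) i"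
    by (rule slice_coeff_cong) (simp add: mixed_weight_def fun_eq_iff)
  then show ?thesis
    unfolding multi_sum_slice[of _ _ _ _ i] by (simp add: mixed_weight_def)
qed

lemma multi_sum_product:
  "multi_sum lam P Q (mixed_weight e lam {} y z)
    = (\<Sum>\<mu> | \<mu> \<le> lam. P \<mu> * (\<Prod>i\<in>UNIV. y i ^ (\<mu> $ i))) * (\<Sum>\<nu> | \<nu> \<le> lam. Q \<nu> * (\<Prod>i\<in>UNIV. z i ^ (\<nu> $ i)))"
  unfolding multi_sum_def sum_product
  by (intro sum.cong refl) (simp add: mixed_weight_def prod.distrib mult_ac)

lemma slice_nonvanishing:
  fixes lam :: "nat ^ 'n::finite"
  assumes nz: "\<And>y z. (\<And>i. Im (y i) > 0) \<Longrightarrow> (\<And>i. Im (z i) < 0)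
      \<Longrightarrow> multi_sum lam P Q (mixed_weight e lam I y z) \<noteq> 0"
    and "i \<notin> I" "\<And>i. Im (y i) > 0" "\<And>i. Im (z i) < 0"
  shows "nonvanishing_upper_lower (lam $ i) (slice_coeff lam P Q (mixed_weight e lam I y z) i)"
  unfolding nonvanishing_upper_lower_def bilin_sum_slice[OF \<open>i \<notin> I\<close>]
  using assms(3,4) by (intro allI impI nz) auto

text \<open>For empty \<open>I\<close> the sum is a product of two nonzero values; inserting an
  index contracts one more pair of variables.\<close>

lemma multi_sum_nonzero:
  fixes lam :: "nat ^ 'n::finite"
  assumes P: "\<And>y. (\<And>i. Im (y i) > 0) \<Longrightarrow> (\<Sum>\<mu> | \<mu> \<le> lam. P \<mu> * (\<Prod>i\<in>UNIV. y i ^ (\<mu> $ i))) \<noteq> 0"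
    and Q: "\<And>z. (\<And>i. Im (z i) < 0) \<Longrightarrow> (\<Sum>\<nu> | \<nu> \<le> lam. Q \<nu> * (\<Prod>i\<in>UNIV. z i ^ (\<nu> $ i))) \<noteq> 0"
    and "\<epsilon> > 0" "\<And>i. Im (y i) > 0" "\<And>i. Im (z i) < 0"
  shows "multi_sum lam P Q (mixed_weight (\<i> * of_real \<epsilon>) lam I y z) \<noteq> 0"
  using finite[of I] assms(4,5)
proof (induction I arbitrary: y z rule: finite_induct)
  case empty
  then show ?case
    using P Q by (simp add: multi_sum_product)
next
  case (insert i I)
  show ?case
    unfolding multi_sum_insert
    by (intro pairing_nonzero slice_nonvanishing insert \<open>\<epsilon> > 0\<close>) (use insert in auto)
qed

text \<open>Contracting the pairs of variables one after another leads from the product of the two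
  polynomials to their pairing, and each index \<open>i\<close> costs \<open>lam $ i\<close> entropy
  factors.\<close>

lemma inner_product_capacity:
  fixes lam :: "nat ^ 'n::finite" and P Q :: "nat ^ 'n \<Rightarrow> real" and \<alpha> :: "real ^ 'n"
  assumes nonneg: "\<And>\<mu>. 0 \<le> P \<mu>" "\<And>\<mu>. 0 \<le> Q \<mu>"
    and P: "\<And>y. (\<And>i. Im (y i) > 0) \<Longrightarrow> (\<Sum>\<mu> | \<mu> \<le> lam. of_real (P \<mu>) * (\<Prod>i\<in>UNIV. y i ^ (\<mu> $ i))) \<noteq> 0"
    and Q: "\<And>y. (\<And>i. Im (y i) > 0) \<Longrightarrow> (\<Sum>\<mu> | \<mu> \<le> lam. of_real (Q \<mu>) * (\<Prod>i\<in>UNIV. y i ^ (\<mu> $ i))) \<noteq> 0"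
    and \<alpha>: "\<And>i. 0 \<le> \<alpha> $ i" "\<And>i. \<alpha> $ i \<le> real (lam $ i)"
    and K: "0 \<le> K" "0 \<le> L"
    and capP: "\<And>x. (\<And>i. 0 < x i) \<Longrightarrow>
        K * (\<Prod>i\<in>UNIV. x i powr \<alpha> $ i) \<le> (\<Sum>\<mu> | \<mu> \<le> lam. P \<mu> * (\<Prod>i\<in>UNIV. x i ^ (\<mu> $ i)))"
    and capQ: "\<And>x. (\<And>i. 0 < x i) \<Longrightarrow>
        L * (\<Prod>i\<in>UNIV. x i powr \<alpha> $ i) \<le> (\<Sum>\<mu> | \<mu> \<le> lam. Q \<mu> * (\<Prod>i\<in>UNIV. x i ^ (\<mu> $ i)))"
  shows "K * L * (\<Prod>i\<in>UNIV. entropy_factor (\<alpha> $ i / real (lam $ i)) ^ (lam $ i))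
    \<le> (\<Sum>\<mu> | \<mu> \<le> lam. P \<mu> * Q \<mu> / real (vec_binomial lam \<mu>))"
proof -
  let ?P = "\<lambda>\<mu>. complex_of_real (P \<mu>)" and ?Q = "\<lambda>\<mu>. complex_of_real (Q \<mu>)"
  let ?E = "\<lambda>i. entropy_factor (\<alpha> $ i / real (lam $ i)) ^ (lam $ i)"
  \<comment> \<open>The coefficients are real, so conjugation moves nonvanishing to the lower
    half-plane.\<close>
  have Q': "(\<Sum>\<nu> | \<nu> \<le> lam. ?Q \<nu> * (\<Prod>i\<in>UNIV. z i ^ (\<nu> $ i))) \<noteq> 0" if "\<And>i. Im (z i) < 0" for z
  proof -
    have "cnj (\<Sum>\<nu> | \<nu> \<le> lam. ?Q \<nu> * (\<Prod>i\<in>UNIV. z i ^ (\<nu> $ i)))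
        = (\<Sum>\<nu> | \<nu> \<le> lam. ?Q \<nu> * (\<Prod>i\<in>UNIV. (cnj (z i)) ^ (\<nu> $ i)))"
      by simp
    then show ?thesis
      using Q[of "\<lambda>i. cnj (z i)"] that by (metis complex_cnj_zero cnj.simps(2) neg_0_less_iff_less)
  qed
  \<comment> \<open>The intermediate stage: factors \<open>?E i\<close> for the indices already
    paired, powers of the variables for the remaining ones.\<close>
  have claim: "K * L * (\<Prod>i\<in>I. ?E i) * (\<Prod>i\<in>-I. (x i * x' i) powr \<alpha> $ i)
      \<le> multi_sum lam P Q (mixed_weight 0 lam I x x')"
    if "\<And>i. 0 < x i" "\<And>i. 0 < x' i" for I x x'
    using finite[of I] that
  proof (induction I arbitrary: x x' rule: finite_induct)
    case empty
    have "K * (\<Prod>i\<in>UNIV. x i powr \<alpha> $ i) * (L * (\<Prod>i\<in>UNIV. x' i powr \<alpha> $ i))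
        \<le> multi_sum lam P Q (mixed_weight 0 lam {} x x')"
      unfolding multi_sum_product
      using empty K nonneg
      by (intro mult_mono capP capQ) (auto intro!: sum_nonneg mult_nonneg_nonneg prod_nonneg zero_le_power simp: less_imp_le)
    then show ?case
      using empty by (simp add: powr_mult prod.distrib less_imp_le mult_ac)
  next
    case (insert i I)
    define \<epsilon> :: "nat \<Rightarrow> real" where "\<epsilon> n = 1 / real (Suc n)" for n
    have \<epsilon>: "\<epsilon> n > 0" for n
      by (simp add: \<epsilon>_def)
    have \<epsilon>lim: "\<epsilon> \<longlonglongrightarrow> 0"
      using LIMSEQ_inverse_real_of_nat by (simp add: \<epsilon>_def[abs_def] inverse_eq_divide)
    define y where "y n l = of_real (x l) + \<i> * of_real (\<epsilon> n)" for n l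
    define z where "z n l = of_real (x' l) - \<i> * of_real (\<epsilon> n)" for n l
    have "(\<lambda>n. y n l) \<longlonglongrightarrow> of_real (x l) + \<i> * of_real 0"
      "(\<lambda>n. z n l) \<longlonglongrightarrow> of_real (x' l) - \<i> * of_real 0" for l
      unfolding y_def z_def by (intro tendsto_intros \<epsilon>lim)+
    then have yz_lim: "(\<lambda>n. y n l) \<longlonglongrightarrow> of_real (x l)" "(\<lambda>n. z n l) \<longlonglongrightarrow> of_real (x' l)" for l
      by simp_all
    have e_lim: "(\<lambda>n. \<i> * complex_of_real (\<epsilon> n)) \<longlonglongrightarrow> 0"
      using tendsto_mult[OF tendsto_const tendsto_of_real[OF \<epsilon>lim], of \<i>] by simp
    let ?A = "slice_coeff lam P Q (mixed_weight 0 lam I x x') i"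
    let ?A' = "\<lambda>n. slice_coeff lam ?P ?Q (mixed_weight (\<i> * of_real (\<epsilon> n)) lam I (y n) (z n)) i"
    let ?K = "K * L * (\<Prod>i\<in>I. ?E i) * (\<Prod>i\<in>-insert i I. (x i * x' i) powr \<alpha> $ i)"
    have "?K * ?E i \<le> (\<Sum>j\<le>lam $ i. \<Sum>k\<le>lam $ i. ?A j k * pairing_matrix 0 (lam $ i) j k)"
    proof (rule pairing_capacity[OF _ _ \<epsilon> \<epsilon>lim, where A' = ?A'])
      show "0 \<le> \<alpha> $ i / real (lam $ i)" "\<alpha> $ i / real (lam $ i) \<le> 1"
        using \<alpha>[of i] by (auto simp: divide_le_eq_1)
      show "0 \<le> ?A j k" for j k
        unfolding slice_coeff_def
        using insert.prems nonneg
        by (intro sum_nonneg mult_nonneg_nonneg prod_nonneg)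
          (auto simp: mixed_weight_def less_imp_le pairing_matrix_0 less_eq_vec_def)
      show "(\<lambda>n. ?A' n j k) \<longlonglongrightarrow> of_real (?A j k)" for j k
      proof -
        have "(\<lambda>n. mixed_weight (\<i> * of_real (\<epsilon> n)) lam I (y n) (z n) l a b)
            \<longlonglongrightarrow> of_real (mixed_weight 0 lam I x x' l a b)" for l a b
        proof (cases "l \<in> I")
          case True
          then show ?thesis
            using pairing_matrix_tendsto[OF e_lim] by (simp add: mixed_weight_def)
        next
          case False
          then show ?thesis
            unfolding mixed_weight_def by (simp, intro tendsto_intros yz_lim)
        qed
        then show ?thesis
          unfolding slice_coeff_def of_real_sum of_real_mult of_real_prod
          by (intro tendsto_intros)
      qed
      show "nonvanishing_upper_lower (lam $ i) (?A' n)" for n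
        using insert.hyps \<epsilon>
        by (intro slice_nonvanishing multi_sum_nonzero P Q') (auto simp: y_def z_def)
      fix v w :: real
      assume vw: "0 < v" "0 < w"
      \<comment> \<open>This holds for \<open>lam $ i = 0\<close> too, since then
        \<open>\<alpha> $ i = 0\<close>.\<close>
      have "\<alpha> $ i / real (lam $ i) * real (lam $ i) = \<alpha> $ i"
        using \<alpha>[of i] by (cases "lam $ i = 0") auto
      moreover have "(\<Prod>l\<in>-I. ((x(i := v)) l * (x'(i := w)) l) powr \<alpha> $ l)
          = (v * w) powr \<alpha> $ i * (\<Prod>l\<in>-insert i I. (x l * x' l) powr \<alpha> $ l)"
      proof -
        have "- I = insert i (- insert i I)"
          using insert.hyps by auto
        then show ?thesis
          by (simp only:) (subst prod.insert, auto intro!: prod.cong)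
      qed
      moreover have "K * L * (\<Prod>i\<in>I. ?E i) * (\<Prod>l\<in>-I. ((x(i := v)) l * (x'(i := w)) l) powr \<alpha> $ l)
          \<le> multi_sum lam P Q (mixed_weight 0 lam I (x(i := v)) (x'(i := w)))"
        by (rule insert.IH) (use insert.prems vw in auto)
      ultimately show "?K * (v * w) powr (\<alpha> $ i / real (lam $ i) * real (lam $ i))
          \<le> bilin_sum (lam $ i) ?A (\<lambda>j. v ^ j) (\<lambda>k. w ^ k)"
        unfolding bilin_sum_slice[OF insert.hyps(2)] by (simp only: mult_ac)
    qed
    then show ?case
      unfolding multi_sum_insert using insert.hyps by (simp add: mult_ac)
  qed
  \<comment> \<open>With every index contracted, the unperturbed weight is diagonal, so only the
    terms with \<open>\<mu> = \<nu>\<close> survive.\<close>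
  have "multi_sum lam P Q (mixed_weight 0 lam UNIV (\<lambda>_. 1) (\<lambda>_. 1))
      = (\<Sum>\<mu> | \<mu> \<le> lam. \<Sum>\<nu> | \<nu> \<le> lam. if \<mu> = \<nu> then P \<mu> * Q \<mu> / real (vec_binomial lam \<mu>) else 0)"
    unfolding multi_sum_def
  proof (intro sum.cong refl)
    fix \<mu> \<nu> assume le: "\<mu> \<in> {\<mu>. \<mu> \<le> lam}" "\<nu> \<in> {\<nu>. \<nu> \<le> lam}"
    have "(\<Prod>i\<in>UNIV. mixed_weight 0 lam UNIV (\<lambda>_. 1) (\<lambda>_. 1) i (\<mu> $ i) (\<nu> $ i))
        = (\<Prod>i\<in>UNIV. if \<mu> $ i = \<nu> $ i then 1 / real (lam $ i choose \<mu> $ i) else 0)"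
      using le by (intro prod.cong refl) (simp add: mixed_weight_def pairing_matrix_0 less_eq_vec_def)
    also have "\<dots> = (if \<mu> = \<nu> then 1 / real (vec_binomial lam \<mu>) else 0)"
      by (auto simp: vec_binomial_def prod_dividef vec_eq_iff)
    finally show "P \<mu> * Q \<nu> * (\<Prod>i\<in>UNIV. mixed_weight 0 lam UNIV (\<lambda>_. 1) (\<lambda>_. 1) i (\<mu> $ i) (\<nu> $ i))
        = (if \<mu> = \<nu> then P \<mu> * Q \<mu> / real (vec_binomial lam \<mu>) else 0)"
      by simp
  qed
  also have "\<dots> = (\<Sum>\<mu> | \<mu> \<le> lam. P \<mu> * Q \<mu> / real (vec_binomial lam \<mu>))"
    by (intro sum.cong refl) (simp add: finite_vec_nat_atMost)
  finally show ?thesis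
    using claim[of "\<lambda>_. 1" "\<lambda>_. 1" UNIV] by simp
qed

section \<open>Evaluation and capacity of polynomials\<close>

lemma poly_eval_superset:
  assumes "finite S" "Poly_Mapping.keys p \<subseteq> S"
  shows "poly_eval p z = (\<Sum>\<mu>\<in>S. of_real (Poly_Mapping.lookup p \<mu>) * (\<Prod>i\<in>UNIV. (z $ i) ^ (\<mu> $ i)))"
  unfolding poly_eval_def using assms
  by (intro sum.mono_neutral_left) (auto simp: in_keys_iff)

lemma poly_eval_polys_le:
  assumes "p \<in> polys_le lam"
  shows "poly_eval p z = (\<Sum>\<mu> | \<mu> \<le> lam. of_real (Poly_Mapping.lookup p \<mu>) * (\<Prod>i\<in>UNIV. (z $ i) ^ (\<mu> $ i)))"
  using assms by (intro poly_eval_superset finite_vec_nat_atMost) (auto simp: polys_le_def)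

lemma poly_eval_0 [simp]: "poly_eval 0 z = 0"
  by (simp add: poly_eval_def)

lemma poly_eval_add: "poly_eval (p + q) z = poly_eval p z + poly_eval q z"
proof -
  define S where "S = Poly_Mapping.keys p \<union> Poly_Mapping.keys q"
  have S: "finite S" "Poly_Mapping.keys p \<subseteq> S" "Poly_Mapping.keys q \<subseteq> S" "Poly_Mapping.keys (p + q) \<subseteq> S"
    using keys_add[of p q] by (auto simp: S_def)
  show ?thesis
    unfolding S(2-4)[THEN poly_eval_superset[OF S(1)]]
    by (simp add: lookup_add distrib_right sum.distrib)
qed

lemma poly_eval_sum: "poly_eval (\<Sum>a\<in>A. f a) z = (\<Sum>a\<in>A. poly_eval (f a) z)"
  by (induction A rule: infinite_finite_induct) (auto simp: poly_eval_add)

lemma poly_eval_monomial: "poly_eval (monomial \<mu> c) z = of_real c * (\<Prod>i\<in>UNIV. (z $ i) ^ (\<mu> $ i))"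
  by (subst poly_eval_superset[of "{\<mu>}"]) auto

lemma poly_eval_monomial_mult:
  "poly_eval (monomial \<mu> c * p) z = of_real c * (\<Prod>i\<in>UNIV. (z $ i) ^ (\<mu> $ i)) * poly_eval p z"
proof -
  have "p = (\<Sum>\<nu>\<in>Poly_Mapping.keys p. monomial \<nu> (Poly_Mapping.lookup p \<nu>))"
    by (intro poly_mapping_eqI) (auto simp: lookup_sum lookup_single when_def in_keys_iff)
  then have "monomial \<mu> c * p
      = (\<Sum>\<nu>\<in>Poly_Mapping.keys p. monomial (\<mu> + \<nu>) (c * Poly_Mapping.lookup p \<nu>))"
    by (metis (no_types, lifting) mult_single sum.cong sum_distrib_left)
  then show ?thesis
    by (simp add: poly_eval_sum poly_eval_monomial poly_eval_def[of p] sum_distrib_left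
        power_add prod.distrib mult_ac)
qed

lemma poly_eval_of_real:
  "poly_eval p (\<chi> i. complex_of_real (x $ i)) = of_real (poly_eval p x)"
  by (simp add: poly_eval_def)

lemma prod_UNIV_sum_type:
  "(\<Prod>s\<in>UNIV. f s) = (\<Prod>i\<in>UNIV. f (Inl i)) * (\<Prod>j\<in>UNIV. f (Inr j))"
  for f :: "'a::finite + 'b::finite \<Rightarrow> 'c::comm_monoid_mult"
  by (simp flip: UNIV_Plus_UNIV add: prod.Plus)

lemma vec_join_nth [simp]: "vec_join u v $ Inl i = u $ i" "vec_join u v $ Inr j = v $ j"
  by (simp_all add: vec_join_def)

lemma poly_eval_lift_right: "poly_eval (lift_right q) (vec_join z x) = poly_eval q x"
  by (simp add: lift_right_def poly_eval_sum poly_eval_monomial poly_eval_def[of q] prod_UNIV_sum_type)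

lemma poly_eval_Symb:
  "poly_eval (Symb lam T) (vec_join z x)
    = (\<Sum>\<mu> | \<mu> \<le> lam. of_nat (vec_binomial lam \<mu>) * (\<Prod>i\<in>UNIV. (z $ i) ^ (\<mu> $ i)) * poly_eval (T (monomial \<mu> 1)) x)"
  by (simp add: Symb_def poly_eval_sum poly_eval_monomial_mult poly_eval_lift_right prod_UNIV_sum_type)

lemma poly_eval_fix_right:
  "poly_eval (fix_right q x) z = poly_eval q (vec_join z (\<chi> j. complex_of_real (x $ j)))"
  by (simp add: fix_right_def poly_eval_sum poly_eval_monomial poly_eval_def[of q] prod_UNIV_sum_type mult_ac)

section \<open>Linear operators on polynomials of bounded degree\<close>

lemma sum_monomial_polys_le:
  assumes "S \<subseteq> {\<mu>. \<mu> \<le> lam}"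
  shows "(\<Sum>\<mu>\<in>S. monomial \<mu> (c \<mu>)) \<in> polys_le lam"
  using assms keys_sum[of "\<lambda>\<mu>. monomial \<mu> (c \<mu>)" S]
  by (fastforce simp: polys_le_def split: if_splits)

lemma linear_on_polys_le_monomial:
  assumes "linear_on_polys_le lam T" "\<mu> \<le> lam"
  shows "T (monomial \<mu> c) = poly_scale c (T (monomial \<mu> 1))"
proof -
  have "monomial \<mu> c = poly_scale c (monomial \<mu> 1)"
    by (simp add: poly_scale_def mult_single)
  moreover have "monomial \<mu> 1 \<in> polys_le lam"
    using assms(2) by (simp add: polys_le_def)
  ultimately show ?thesis
    using assms(1) by (metis linear_on_polys_le_def)
qed

lemma poly_eval_scale: "poly_eval (poly_scale c p) z = of_real c * poly_eval p z"
  by (simp add: poly_scale_def poly_eval_monomial_mult)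

lemma linear_on_polys_le_sum:
  assumes T: "linear_on_polys_le lam T" and "S \<subseteq> {\<mu>. \<mu> \<le> lam}"
  shows "poly_eval (T (\<Sum>\<mu>\<in>S. monomial \<mu> (c \<mu>))) x
    = (\<Sum>\<mu>\<in>S. of_real (c \<mu>) * poly_eval (T (monomial \<mu> 1)) x)"
proof -
  have "finite S"
    using assms(2) finite_vec_nat_atMost by (rule finite_subset)
  then show ?thesis
    using assms(2)
  proof (induction S rule: finite_induct)
    case empty
    have "T 0 = 0"
      using linear_on_polys_le_monomial[OF T order.refl, of 0]
      by (simp add: poly_scale_def)
    then show ?case
      by simp
  next
    case (insert \<mu> S)
    have "monomial \<mu> (c \<mu>) \<in> polys_le lam"
      using insert.prems by (auto simp: polys_le_def)
    moreover have "(\<Sum>\<mu>\<in>S. monomial \<mu> (c \<mu>)) \<in> polys_le lam"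
      using insert.prems by (intro sum_monomial_polys_le) auto
    ultimately have "T (monomial \<mu> (c \<mu>) + (\<Sum>\<mu>\<in>S. monomial \<mu> (c \<mu>)))
        = T (monomial \<mu> (c \<mu>)) + T (\<Sum>\<mu>\<in>S. monomial \<mu> (c \<mu>))"
      using T unfolding linear_on_polys_le_def by blast
    then show ?case
      using insert linear_on_polys_le_monomial[OF T, of \<mu> "c \<mu>"]
      by (simp add: poly_eval_add poly_eval_scale)
  qed
qed

lemma poly_eval_linear_on_polys_le:
  assumes T: "linear_on_polys_le lam T" and p: "p \<in> polys_le lam"
  shows "poly_eval (T p) x
    = (\<Sum>\<mu> | \<mu> \<le> lam. of_real (Poly_Mapping.lookup p \<mu>) * poly_eval (T (monomial \<mu> 1)) x)"
proof -
  have "p = (\<Sum>\<mu> | \<mu> \<le> lam. monomial \<mu> (Poly_Mapping.lookup p \<mu>))"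
    using p by (intro poly_mapping_eqI)
      (auto simp: lookup_sum lookup_single when_def finite_vec_nat_atMost polys_le_def in_keys_iff)
  then have "poly_eval (T p) x
      = poly_eval (T (\<Sum>\<mu> | \<mu> \<le> lam. monomial \<mu> (Poly_Mapping.lookup p \<mu>))) x"
    by (rule arg_cong)
  also have "\<dots> = (\<Sum>\<mu> | \<mu> \<le> lam. of_real (Poly_Mapping.lookup p \<mu>) * poly_eval (T (monomial \<mu> 1)) x)"
    by (rule linear_on_polys_le_sum[OF T order.refl])
  finally show ?thesis .
qed

section \<open>Bounds for the capacity\<close>

lemma poly_eval_nonneg:
  assumes "p \<in> nonneg_polys_le lam" "\<And>i. 0 \<le> x $ i"
  shows "0 \<le> (poly_eval p x :: real)"
  using assms unfolding poly_eval_def nonneg_polys_le_def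
  by (auto intro!: sum_nonneg mult_nonneg_nonneg prod_nonneg)

lemma Cap_le:
  assumes "\<And>x :: real ^ 'n. (\<And>i. 0 < x $ i) \<Longrightarrow> 0 \<le> poly_eval p x"
    and x: "\<And>i. 0 < x $ i"
  shows "Cap \<alpha> p * (\<Prod>i\<in>UNIV. (x $ i) powr (\<alpha> $ i)) \<le> poly_eval p (x :: real ^ 'n::finite)"
proof -
  have "bdd_below ((\<lambda>x. poly_eval p x / (\<Prod>i\<in>UNIV. (x $ i) powr (\<alpha> $ i))) ` {x. \<forall>i. 0 < x $ i})"
    using assms(1) by (intro bdd_belowI2[of _ 0] divide_nonneg_nonneg prod_nonneg) auto
  then have "Cap \<alpha> p \<le> poly_eval p x / (\<Prod>i\<in>UNIV. (x $ i) powr (\<alpha> $ i))"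
    unfolding Cap_def using x by (intro cINF_lower) auto
  moreover have "0 < (\<Prod>i\<in>UNIV. (x $ i) powr (\<alpha> $ i))"
    using x by (intro prod_pos) (auto simp: less_le)
  ultimately show ?thesis
    by (simp add: field_simps)
qed

lemma Cap_ge:
  fixes \<alpha> :: "real ^ 'n::finite"
  assumes "\<And>x. (\<And>i. 0 < x $ i) \<Longrightarrow> K * (\<Prod>i\<in>UNIV. (x $ i) powr (\<alpha> $ i)) \<le> poly_eval p x"
  shows "K \<le> Cap \<alpha> p"
  unfolding Cap_def
proof (rule cINF_greatest)
  have "vec 1 \<in> {x :: real ^ 'n. \<forall>i. 0 < x $ i}"
    by simp
  then show "{x :: real ^ 'n. \<forall>i. 0 < x $ i} \<noteq> {}"
    by blast
  fix x :: "real ^ 'n"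
  assume x: "x \<in> {x. \<forall>i. 0 < x $ i}"
  then have "0 < (\<Prod>i\<in>UNIV. (x $ i) powr (\<alpha> $ i))"
    by (intro prod_pos) (auto simp: less_le)
  then show "K \<le> poly_eval p x / (\<Prod>i\<in>UNIV. (x $ i) powr (\<alpha> $ i))"
    using assms[of x] x by (simp add: field_simps)
qed

text \<open>Let \<open>?m\<close> be the smallest nonzero coefficient. The exponents
  \<open>a\<close> for which \<open>?m\<close> times the monomial with exponent \<open>a\<close>
  stays below \<open>p\<close> on the positive orthant form a convex set by weighted AM-GM. It
  contains the exponents of \<open>p\<close>, hence all of \<open>Newt p\<close>.\<close>

lemma Cap_pos:
  fixes \<alpha> :: "real ^ 'n::finite"
  assumes p: "p \<in> nonneg_polys_le lam" and \<alpha>: "\<alpha> \<in> Newt p"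
  shows "0 < Cap \<alpha> p"
proof -
  let ?m = "Min (Poly_Mapping.lookup p ` Poly_Mapping.keys p)"
  let ?S = "{a :: real ^ 'n. \<forall>x. (\<forall>i. 0 < x $ i) \<longrightarrow> ?m * (\<Prod>i\<in>UNIV. (x $ i) powr (a $ i)) \<le> poly_eval p x}"
  have ne: "Poly_Mapping.keys p \<noteq> {}"
    using \<alpha> by (auto simp: Newt_def)
  have m: "0 < ?m"
    using p ne by (subst Min_gr_iff) (auto simp: nonneg_polys_le_def less_le in_keys_iff)
  have "convex ?S"
  proof (rule convexI, intro CollectI allI impI)
    fix a b :: "real ^ 'n" and u v :: real and x :: "real ^ 'n"
    assume a: "a \<in> ?S" and b: "b \<in> ?S" and uv: "0 \<le> u" "0 \<le> v" "u + v = 1" and x: "\<forall>i. 0 < x $ i"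
    let ?X = "\<lambda>a :: real ^ 'n. (\<Prod>i\<in>UNIV. (x $ i) powr (a $ i))"
    have pos: "?X a > 0" for a
      using x by (intro prod_pos) (auto simp: less_le)
    have "?X (u *\<^sub>R a + v *\<^sub>R b) = ?X a powr u * ?X b powr v"
      using x
      by (simp add: prod_powr_distrib powr_add powr_powr prod.distrib less_imp_le mult.commute)
    also have "\<dots> \<le> u * ?X a + v * ?X b"
      using pos uv by (intro Youngs_inequality_0)
    finally have "?m * ?X (u *\<^sub>R a + v *\<^sub>R b) \<le> ?m * (u * ?X a + v * ?X b)"
      using m by (intro mult_left_mono) auto
    also have "\<dots> = u * (?m * ?X a) + v * (?m * ?X b)"
      by (simp only: distrib_left mult_ac)
    also have "\<dots> \<le> u * poly_eval p x + v * poly_eval p x"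
      using a b x uv by (intro add_mono mult_left_mono) auto
    also have "\<dots> = poly_eval p x"
      using uv by (simp flip: distrib_right)
    finally show "?m * ?X (u *\<^sub>R a + v *\<^sub>R b) \<le> poly_eval p x" .
  qed
  moreover have "real_vec ` Poly_Mapping.keys p \<subseteq> ?S"
  proof (clarify)
    fix \<mu> and x :: "real ^ 'n"
    assume \<mu>: "\<mu> \<in> Poly_Mapping.keys p" and x: "\<forall>i. 0 < x $ i"
    have "?m * (\<Prod>i\<in>UNIV. (x $ i) powr (real_vec \<mu> $ i))
        \<le> Poly_Mapping.lookup p \<mu> * (\<Prod>i\<in>UNIV. (x $ i) powr (real_vec \<mu> $ i))"
      using \<mu> by (intro mult_right_mono prod_nonneg) auto
    also have "\<dots> = of_real (Poly_Mapping.lookup p \<mu>) * (\<Prod>i\<in>UNIV. (x $ i) ^ (\<mu> $ i))"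
      using x by (simp add: real_vec_def powr_realpow)
    also have "\<dots> \<le> poly_eval p x"
      unfolding poly_eval_def using p \<mu> x
      by (intro member_le_sum mult_nonneg_nonneg prod_nonneg) (auto simp: nonneg_polys_le_def less_imp_le)
    finally show "?m * (\<Prod>i\<in>UNIV. (x $ i) powr (real_vec \<mu> $ i)) \<le> poly_eval p x" .
  qed
  ultimately have "convex hull (real_vec ` Poly_Mapping.keys p) \<subseteq> ?S"
    by (intro hull_minimal)
  then have "?m \<le> Cap \<alpha> p"
    using \<alpha> by (intro Cap_ge) (auto simp: Newt_def)
  then show ?thesis
    using m by simp
qed

section \<open>The constant of the theorem as a product of entropy factors\<close>

lemma self_powr_divide_power:
  assumes "0 \<le> a" "0 < l"
  shows "self_powr (a / real l) ^ l = self_powr a / real l powr a"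
  using assms by (simp add: self_powr_def powr_power flip: powr_divide)

text \<open>The denominators \<open>l powr a\<close> and \<open>l powr (l - a)\<close> combine to
  \<open>l powr l\<close>; for \<open>l = 0\<close> all terms are 1 by the convention for zero to
  the zero.\<close>

lemma entropy_factor_power:
  assumes "0 \<le> a" "a \<le> real l"
  shows "entropy_factor (a / real l) ^ l = self_powr a * self_powr (real l - a) / self_powr (real l)"
proof (cases "l = 0")
  case True
  then show ?thesis
    using assms by (simp add: self_powr_def)
next
  case False
  have "1 - a / real l = (real l - a) / real l"
    using False by (simp add: field_simps)
  then have "entropy_factor (a / real l) ^ l
      = (self_powr a / real l powr a) * (self_powr (real l - a) / real l powr (real l - a))"
    using assms False unfolding entropy_factor_def power_mult_distrib
    by (simp add: self_powr_divide_power)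
  also have "\<dots> = self_powr a * self_powr (real l - a) / (real l powr a * real l powr (real l - a))"
    by simp
  also have "real l powr a * real l powr (real l - a) = self_powr (real l)"
    using False by (simp add: self_powr_def flip: powr_add)
  finally show ?thesis .
qed

lemma self_power_ratio:
  assumes "\<And>i. 0 \<le> \<alpha> $ i" "\<And>i. \<alpha> $ i \<le> real (lam $ i)"
  shows "self_power \<alpha> * self_power (real_vec lam - \<alpha>) / self_power (real_vec lam)
    = (\<Prod>i\<in>UNIV. entropy_factor (\<alpha> $ i / real (lam $ i)) ^ (lam $ i))"
proof -
  have "self_power v = (\<Prod>i\<in>UNIV. self_powr (v $ i))" for v :: "real ^ 'a"
    by (simp add: self_power_def self_powr_def)
  then show ?thesis
    using assms by (simp add: entropy_factor_power real_vec_def prod.distrib prod_dividef)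
qed

text \<open>Weighted AM-GM for \<open>1 / (1 - s)\<close> and \<open>v / s\<close> with weights
  \<open>1 - s\<close> and \<open>s\<close>. This is the sharp inequality behind the tightness of
  the bound.\<close>

lemma powr_le_entropy_factor:
  assumes "0 < v" "0 \<le> s" "s \<le> 1"
  shows "v powr s \<le> entropy_factor s * (1 + v)"
proof -
  consider "s = 0" | "s = 1" | "0 < s" "s < 1"
    using assms by linarith
  then show ?thesis
  proof cases
    case 3
    have "(1 / (1 - s)) powr (1 - s) * (v / s) powr s \<le> (1 - s) * (1 / (1 - s)) + s * (v / s)"
      using 3 assms by (intro Youngs_inequality_0) auto
    also have "\<dots> = 1 + v"
      using 3 by simp
    finally show ?thesis
      using 3 assms by (simp add: powr_divide entropy_factor_def self_powr_def field_simps)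
  qed (use assms in \<open>auto simp: entropy_factor_def self_powr_def\<close>)
qed

lemma powr_le_entropy_factor_power:
  assumes "0 < v" "0 \<le> a" "a \<le> real l"
  shows "v powr a \<le> entropy_factor (a / real l) ^ l * (1 + v) ^ l"
proof (cases "l = 0")
  case False
  have "v powr a = (v powr (a / real l)) ^ l"
    using False assms by (simp add: powr_power)
  also have "\<dots> \<le> (entropy_factor (a / real l) * (1 + v)) ^ l"
    using assms False by (intro power_mono powr_le_entropy_factor) (auto simp: divide_le_eq_1)
  finally show ?thesis
    by (simp add: power_mult_distrib)
qed (use assms in auto)

section \<open>Test polynomials for tightness\<close>

lemma sum_prod_vec_atMost:
  fixes f :: "'n::finite \<Rightarrow> nat \<Rightarrow> 'a::comm_semiring_1"
  shows "(\<Sum>\<mu> | \<mu> \<le> lam. \<Prod>i\<in>UNIV. f i (\<mu> $ i)) = (\<Prod>i\<in>UNIV. \<Sum>j\<le>lam $ i. f i j)"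
proof -
  have "(\<Prod>i\<in>UNIV. \<Sum>j\<le>lam $ i. f i j) = (\<Sum>g\<in>Pi\<^sub>E UNIV (\<lambda>i. {..lam $ i}). \<Prod>i\<in>UNIV. f i (g i))"
    by (intro prod_sum_PiE) auto
  also have "\<dots> = (\<Sum>\<mu> | \<mu> \<le> lam. \<Prod>i\<in>UNIV. f i (\<mu> $ i))"
    by (rule sum.reindex_bij_witness[of _ vec_nth vec_lambda]) (auto simp: less_eq_vec_def PiE_iff)
  finally show ?thesis
    by simp
qed

text \<open>The polynomial \<open>\<Prod>\<^sub>i (1 + y\<^sub>i x\<^sub>i)\<^bsup>\<lambda>\<^sub>i\<^esup>\<close>, whose image under \<open>T\<close> is the symbol at \<open>z = y\<close>.\<close>

definition binomial_rpoly :: "nat ^ 'n \<Rightarrow> real ^ 'n \<Rightarrow> 'n::finite rpoly" where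
  "binomial_rpoly lam y =
     (\<Sum>\<mu> | \<mu> \<le> lam. monomial \<mu> (real (vec_binomial lam \<mu>) * (\<Prod>i\<in>UNIV. (y $ i) ^ (\<mu> $ i))))"

lemma lookup_binomial_rpoly:
  "Poly_Mapping.lookup (binomial_rpoly lam y) \<mu>
    = (if \<mu> \<le> lam then real (vec_binomial lam \<mu>) * (\<Prod>i\<in>UNIV. (y $ i) ^ (\<mu> $ i)) else 0)"
  by (simp add: binomial_rpoly_def lookup_sum lookup_single when_def finite_vec_nat_atMost)

lemma keys_binomial_rpoly:
  assumes "\<And>i. 0 < y $ i"
  shows "Poly_Mapping.keys (binomial_rpoly lam y) = {\<mu>. \<mu> \<le> lam}"
proof -
  have "(\<Prod>i\<in>UNIV. (y $ i) ^ (\<mu> $ i)) \<noteq> 0" for \<mu>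
    using assms by (simp add: less_imp_neq[symmetric])
  then show ?thesis
    by (simp add: set_eq_iff in_keys_iff lookup_binomial_rpoly)
      (simp add: vec_binomial_def less_eq_vec_def binomial_eq_0_iff not_less)
qed

lemma binomial_rpoly_nonneg:
  assumes "\<And>i. 0 < y $ i"
  shows "binomial_rpoly lam y \<in> nonneg_polys_le lam"
  using assms
  by (auto simp: nonneg_polys_le_def polys_le_def keys_binomial_rpoly lookup_binomial_rpoly less_imp_le
      intro!: mult_nonneg_nonneg prod_nonneg)

lemma poly_eval_binomial_rpoly:
  "poly_eval (binomial_rpoly lam y) z = (\<Prod>i\<in>UNIV. (1 + of_real (y $ i) * z $ i) ^ (lam $ i))"
proof -
  have "poly_eval (binomial_rpoly lam y) z
      = (\<Sum>\<mu> | \<mu> \<le> lam. \<Prod>i\<in>UNIV. of_nat (lam $ i choose \<mu> $ i) * (of_real (y $ i) * z $ i) ^ (\<mu> $ i))"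
    by (simp add: binomial_rpoly_def poly_eval_sum poly_eval_monomial vec_binomial_def
        power_mult_distrib prod.distrib mult_ac)
  also have "\<dots> = (\<Prod>i\<in>UNIV. \<Sum>j\<le>lam $ i. of_nat (lam $ i choose j) * (of_real (y $ i) * z $ i) ^ j)"
    by (rule sum_prod_vec_atMost)
  also have "\<dots> = (\<Prod>i\<in>UNIV. (1 + of_real (y $ i) * z $ i) ^ (lam $ i))"
    by (intro prod.cong refl) (simp add: add.commute[of 1] binomial_ring)
  finally show ?thesis .
qed

lemma real_stable_binomial_rpoly:
  assumes "\<And>i. 0 < y $ i"
  shows "real_stable (binomial_rpoly lam y)"
proof -
  have "1 + of_real (y $ i) * z \<noteq> 0" if "0 < Im z" for i z
    using assms[of i] that by (auto simp: complex_eq_iff)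
  then show ?thesis
    by (simp add: real_stable_def poly_eval_binomial_rpoly)
qed

text \<open>The box of all \<open>\<alpha>\<close> between 0 and \<open>lam\<close> is the image of
  the unit cube under coordinatewise scaling, and the vertices of the cube go to exponent vectors
  with entries 0 or \<open>lam $ i\<close>.\<close>

lemma Newt_binomial_rpoly:
  assumes y: "\<And>i. 0 < y $ i" and \<alpha>: "\<And>i. 0 \<le> \<alpha> $ i" "\<And>i. \<alpha> $ i \<le> real (lam $ i)"
  shows "\<alpha> \<in> Newt (binomial_rpoly lam (y :: real ^ 'n::finite))"
proof -
  define f where "f x = (\<chi> i. real (lam $ i) * x $ i)" for x :: "real ^ 'n"
  \<comment> \<open>Where \<open>lam $ i = 0\<close>, the quotient is 0 and
    \<open>\<alpha> $ i = 0\<close>, so \<open>f t = \<alpha>\<close> still holds.\<close>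
  define t :: "real ^ 'n" where "t = (\<chi> i. \<alpha> $ i / real (lam $ i))"
  have "linear f"
    by (rule linearI) (simp_all add: f_def vec_eq_iff algebra_simps)
  have "t \<in> cbox 0 1"
    using \<alpha> by (auto simp: mem_box_cart t_def divide_le_eq_1)
  moreover have "f t = \<alpha>"
    using \<alpha> by (auto simp: vec_eq_iff f_def t_def) (metis of_nat_0 order_antisym)
  moreover have "cbox 0 (1 :: real ^ 'n) = convex hull {x. \<forall>i. x $ i = 0 \<or> x $ i = 1}"
    using unit_interval_convex_hull[where 'a = "real ^ 'n"]
    unfolding Cart_1[symmetric] by (simp add: Basis_vec_def inner_axis)
  ultimately have "\<alpha> \<in> f ` (convex hull {x. \<forall>i. x $ i = 0 \<or> x $ i = 1})"
    by force
  also have "\<dots> = convex hull (f ` {x. \<forall>i. x $ i = 0 \<or> x $ i = 1})"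
    by (rule convex_hull_linear_image[OF \<open>linear f\<close>])
  also have "\<dots> \<subseteq> convex hull (real_vec ` {\<mu>. \<mu> \<le> lam})"
  proof (intro hull_mono subsetI)
    fix w assume "w \<in> f ` {x. \<forall>i. x $ i = 0 \<or> x $ i = 1}"
    then obtain x where x: "w = f x" "\<forall>i. x $ i = 0 \<or> x $ i = 1"
      by blast
    define \<mu> :: "nat ^ 'n" where "\<mu> = (\<chi> i. if x $ i = 0 then 0 else lam $ i)"
    have "w = real_vec \<mu>"
      using x(2) by (auto simp: x(1) f_def real_vec_def \<mu>_def vec_eq_iff)
    moreover have "\<mu> \<le> lam"
      by (simp add: less_eq_vec_def \<mu>_def)
    ultimately show "w \<in> real_vec ` {\<mu>. \<mu> \<le> lam}"
      by blast
  qed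
  finally show ?thesis
    using y by (simp add: Newt_def keys_binomial_rpoly)
qed

text \<open>In each coordinate this is \<open>powr_le_entropy_factor_power\<close> at
  \<open>v = y $ i * x $ i\<close>; multiplying over the coordinates gives a lower bound for the
  polynomial at every positive \<open>x\<close>.\<close>

lemma Cap_binomial_rpoly_ge:
  fixes y :: "real ^ 'n::finite"
  assumes y: "\<And>i. 0 < y $ i" and \<alpha>: "\<And>i. 0 \<le> \<alpha> $ i" "\<And>i. \<alpha> $ i \<le> real (lam $ i)"
  shows "(\<Prod>i\<in>UNIV. (y $ i) powr (\<alpha> $ i))
    \<le> (\<Prod>i\<in>UNIV. entropy_factor (\<alpha> $ i / real (lam $ i)) ^ (lam $ i)) * Cap \<alpha> (binomial_rpoly lam y)"
proof -
  let ?C = "\<Prod>i\<in>UNIV. entropy_factor (\<alpha> $ i / real (lam $ i)) ^ (lam $ i)"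
  have C: "0 < ?C"
    using \<alpha> by (intro prod_pos) (auto intro!: zero_less_power entropy_factor_pos simp: divide_le_eq_1)
  have "(\<Prod>i\<in>UNIV. (y $ i) powr (\<alpha> $ i)) / ?C \<le> Cap \<alpha> (binomial_rpoly lam y)"
  proof (rule Cap_ge)
    fix x :: "real ^ 'n" assume x: "\<And>i. 0 < x $ i"
    have "(\<Prod>i\<in>UNIV. (y $ i) powr (\<alpha> $ i)) * (\<Prod>i\<in>UNIV. (x $ i) powr (\<alpha> $ i))
        = (\<Prod>i\<in>UNIV. (y $ i * x $ i) powr (\<alpha> $ i))"
      using x y by (simp add: powr_mult less_imp_le prod.distrib)
    also have "\<dots> \<le> (\<Prod>i\<in>UNIV. entropy_factor (\<alpha> $ i / real (lam $ i)) ^ (lam $ i) * (1 + y $ i * x $ i) ^ (lam $ i))"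
      using x y \<alpha> by (intro prod_mono conjI powr_le_entropy_factor_power) auto
    also have "\<dots> = ?C * poly_eval (binomial_rpoly lam y) x"
      by (simp add: poly_eval_binomial_rpoly prod.distrib)
    finally show "(\<Prod>i\<in>UNIV. (y $ i) powr (\<alpha> $ i)) / ?C * (\<Prod>i\<in>UNIV. (x $ i) powr (\<alpha> $ i))
        \<le> poly_eval (binomial_rpoly lam y) x"
      using C by (simp add: field_simps)
  qed
  then show ?thesis
    using C by (simp add: field_simps)
qed

section \<open>From the pairing to the operator\<close>

lemma poly_eval_linear_nonneg:
  fixes lam :: "nat ^ 'n::finite" and x :: "real ^ 'm::finite" and T :: "'n rpoly \<Rightarrow> 'm rpoly"
  assumes T_nonneg: "\<And>p. p \<in> nonneg_polys_le lam \<Longrightarrow> T p \<in> nonneg_polys_le \<gamma>"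
    and "\<mu> \<le> lam" "\<And>j. 0 < x $ j"
  shows "0 \<le> poly_eval (T (monomial \<mu> 1)) x"
proof (rule poly_eval_nonneg[OF T_nonneg])
  show "monomial \<mu> 1 \<in> nonneg_polys_le lam"
    using assms(2) by (simp add: nonneg_polys_le_def polys_le_def lookup_single when_def)
qed (use assms(3) in \<open>simp add: less_imp_le\<close>)

text \<open>For fixed positive \<open>x\<close> the value of \<open>T p\<close> is the pairing of
  \<open>p\<close> with the symbol as a polynomial in \<open>z\<close>, so
  \<open>inner_product_capacity\<close> applies pointwise in \<open>x\<close>.\<close>

lemma Cap_image_ge:
  fixes lam :: "nat ^ 'n::finite" and \<gamma> :: "nat ^ 'm::finite"
    and T :: "'n rpoly \<Rightarrow> 'm rpoly" and \<alpha> :: "real ^ 'n" and \<beta> :: "real ^ 'm"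
  assumes T_linear: "linear_on_polys_le lam T"
    and T_nonneg: "\<And>p. p \<in> nonneg_polys_le lam \<Longrightarrow> T p \<in> nonneg_polys_le \<gamma>"
    and symb_stable: "\<And>x :: real ^ 'm. (\<forall>j. 0 \<le> x $ j) \<Longrightarrow> real_stable (fix_right (Symb lam T) x)"
    and \<alpha>: "\<And>i. 0 \<le> \<alpha> $ i" "\<And>i. \<alpha> $ i \<le> real (lam $ i)"
    and p: "p \<in> nonneg_polys_le lam" "real_stable p" "p \<noteq> 0"
  shows "Cap \<alpha> p * Cap (vec_join \<alpha> \<beta>) (Symb lam T)
      * (\<Prod>i\<in>UNIV. entropy_factor (\<alpha> $ i / real (lam $ i)) ^ (lam $ i)) \<le> Cap \<beta> (T p)"
proof (rule Cap_ge)
  fix x :: "real ^ 'm"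
  assume x: "\<And>j. 0 < x $ j"
  let ?C = "\<Prod>i\<in>UNIV. entropy_factor (\<alpha> $ i / real (lam $ i)) ^ (lam $ i)"
  let ?S = "Cap (vec_join \<alpha> \<beta>) (Symb lam T)"
  let ?X = "\<Prod>j\<in>UNIV. (x $ j) powr (\<beta> $ j)"
  define c where "c \<mu> = poly_eval (T (monomial \<mu> 1)) x" for \<mu>
  \<comment> \<open>The coefficients in \<open>z\<close> of the symbol at \<open>x\<close>; the
    division by the binomial in the pairing turns them back into \<open>c\<close>.\<close>
  define Q where "Q \<mu> = real (vec_binomial lam \<mu>) * c \<mu>" for \<mu>
  have X: "0 < ?X"
    using x by (intro prod_pos) (auto simp: less_le)
  have pl: "p \<in> polys_le lam"
    using p(1) by (simp add: nonneg_polys_le_def)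
  have Q0: "0 \<le> Q \<mu>" for \<mu>
  proof (cases "\<mu> \<le> lam")
    case True
    then show ?thesis
      using poly_eval_linear_nonneg[where T = T, OF T_nonneg True x] by (simp add: Q_def c_def)
  next
    case False
    then have "vec_binomial lam \<mu> = 0"
      by (auto simp: vec_binomial_def less_eq_vec_def not_le)
    then show ?thesis
      by (simp add: Q_def)
  qed
  have symb_nonneg: "0 \<le> poly_eval (Symb lam T) w" if w: "\<And>s. 0 < w $ s" for w :: "real ^ ('n + 'm)"
  proof -
    define u v where "u = (\<chi> i. w $ Inl i)" and "v = (\<chi> j. w $ Inr j)"
    have "w = vec_join u v"
      by (simp add: u_def v_def vec_eq_iff vec_join_def split: sum.split)
    moreover have "0 \<le> poly_eval (Symb lam T) (vec_join u v)"
      unfolding poly_eval_Symb using w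
      by (intro sum_nonneg mult_nonneg_nonneg prod_nonneg poly_eval_linear_nonneg[where T = T, OF T_nonneg])
        (auto simp: u_def v_def less_imp_le)
    ultimately show ?thesis
      by simp
  qed
  have S0: "0 \<le> ?S"
    using symb_nonneg by (intro Cap_ge) simp
  have p0: "0 \<le> Cap \<alpha> p"
    using poly_eval_nonneg[OF p(1)] by (intro Cap_ge) (simp add: less_imp_le)
  \<comment> \<open>With \<open>x\<close> frozen, the joint capacity of the symbol bounds it below
    as a function of \<open>z\<close> alone, with the constant \<open>?S * ?X\<close>.\<close>
  have capQ: "?S * ?X * (\<Prod>i\<in>UNIV. y i powr \<alpha> $ i) \<le> (\<Sum>\<mu> | \<mu> \<le> lam. Q \<mu> * (\<Prod>i\<in>UNIV. y i ^ (\<mu> $ i)))"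
    if y: "\<And>i. 0 < y i" for y
  proof -
    have pos: "0 < vec_join (\<chi> i. y i) x $ s" for s
      using x y by (cases s) auto
    have "?S * (\<Prod>s\<in>UNIV. (vec_join (\<chi> i. y i) x $ s) powr (vec_join \<alpha> \<beta> $ s))
        \<le> poly_eval (Symb lam T) (vec_join (\<chi> i. y i) x)"
      using symb_nonneg pos by (rule Cap_le)
    then show ?thesis
      by (simp add: prod_UNIV_sum_type poly_eval_Symb Q_def c_def mult_ac)
  qed
  have "Cap \<alpha> p * (?S * ?X) * ?C \<le> (\<Sum>\<mu> | \<mu> \<le> lam. Poly_Mapping.lookup p \<mu> * Q \<mu> / real (vec_binomial lam \<mu>))"
  proof (cases "fix_right (Symb lam T) x = 0")
    \<comment> \<open>Real stability admits the zero polynomial. If the symbol vanishes identically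
      in \<open>z\<close>, its bound at the point with all coordinates 1 forces
      \<open>?S = 0\<close>, and the left-hand side is zero.\<close>
    case True
    have "complex_of_real (\<Sum>\<mu> | \<mu> \<le> lam. Q \<mu> * (\<Prod>i\<in>UNIV. 1 ^ (\<mu> $ i)))
        = poly_eval (fix_right (Symb lam T) x) (\<chi> i. 1)"
      by (simp add: poly_eval_fix_right poly_eval_Symb Q_def c_def poly_eval_of_real)
    then have "(\<Sum>\<mu> | \<mu> \<le> lam. Q \<mu> * (\<Prod>i\<in>UNIV. 1 ^ (\<mu> $ i))) = 0"
      using True by (simp only: poly_eval_0 of_real_eq_0_iff)
    then have "?S * ?X \<le> 0"
      using capQ[of "\<lambda>_. 1"] by simp
    then have "?S = 0"
      using S0 X by (simp add: mult_le_0_iff)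
    then show ?thesis
      using p(1) Q0 by (auto intro!: sum_nonneg simp: nonneg_polys_le_def)
  next
    case False
    show ?thesis
    proof (rule inner_product_capacity)
      show "0 \<le> Poly_Mapping.lookup p \<mu>" for \<mu>
        using p(1) by (simp add: nonneg_polys_le_def)
      show "0 \<le> Q \<mu>" for \<mu>
        by (rule Q0)
      fix y :: "'n \<Rightarrow> complex"
      assume y: "\<And>i. 0 < Im (y i)"
      have "poly_eval p (\<chi> i. y i) \<noteq> 0"
        using p(2,3) y by (simp add: real_stable_def)
      then show "(\<Sum>\<mu> | \<mu> \<le> lam. of_real (Poly_Mapping.lookup p \<mu>) * (\<Prod>i\<in>UNIV. y i ^ (\<mu> $ i))) \<noteq> 0"
        by (simp add: poly_eval_polys_le[OF pl])
      have "poly_eval (fix_right (Symb lam T) x) (\<chi> i. y i) \<noteq> 0"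
        using symb_stable[of x] False x y by (simp add: real_stable_def less_imp_le)
      then show "(\<Sum>\<mu> | \<mu> \<le> lam. of_real (Q \<mu>) * (\<Prod>i\<in>UNIV. y i ^ (\<mu> $ i))) \<noteq> 0"
        by (simp add: poly_eval_fix_right poly_eval_Symb Q_def c_def poly_eval_of_real mult_ac)
    next
      fix y :: "'n \<Rightarrow> real"
      assume y: "\<And>i. 0 < y i"
      have "Cap \<alpha> p * (\<Prod>i\<in>UNIV. ((\<chi> i. y i) $ i) powr (\<alpha> $ i)) \<le> poly_eval p (\<chi> i. y i)"
        using y poly_eval_nonneg[OF p(1)] by (intro Cap_le) (auto simp: less_imp_le)
      then show "Cap \<alpha> p * (\<Prod>i\<in>UNIV. y i powr \<alpha> $ i)
          \<le> (\<Sum>\<mu> | \<mu> \<le> lam. Poly_Mapping.lookup p \<mu> * (\<Prod>i\<in>UNIV. y i ^ (\<mu> $ i)))"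
        by (simp add: poly_eval_polys_le[OF pl])
    qed (use \<alpha> p0 S0 X capQ in auto)
  qed
  also have "\<dots> = poly_eval (T p) x"
    unfolding poly_eval_linear_on_polys_le[OF T_linear pl]
  proof (intro sum.cong refl)
    fix \<mu> assume "\<mu> \<in> {\<mu>. \<mu> \<le> lam}"
    then have "vec_binomial lam \<mu> \<noteq> 0"
      by (simp add: vec_binomial_def less_eq_vec_def not_less)
    then show "Poly_Mapping.lookup p \<mu> * Q \<mu> / real (vec_binomial lam \<mu>)
        = of_real (Poly_Mapping.lookup p \<mu>) * poly_eval (T (monomial \<mu> 1)) x"
      by (simp add: Q_def c_def)
  qed
  finally show "Cap \<alpha> p * ?S * ?C * ?X \<le> poly_eval (T p) x"
    by (simp only: mult_ac)
qed

theorem theorem4p11: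
  fixes lam :: "nat ^ 'n::finite" and \<gamma> :: "nat ^ 'm::finite"
    and T :: "'n rpoly \<Rightarrow> 'm rpoly"
    and \<alpha> :: "real ^ 'n" and \<beta> :: "real ^ 'm"
  assumes T_range: "\<And>p. p \<in> polys_le lam \<Longrightarrow> T p \<in> polys_le \<gamma>"
    and T_linear: "linear_on_polys_le lam T"
    and T_nonneg: "\<And>p. p \<in> nonneg_polys_le lam \<Longrightarrow> T p \<in> nonneg_polys_le \<gamma>"
    and symb_stable: "\<And>x :: real ^ 'm. (\<forall>j. 0 \<le> x $ j) \<Longrightarrow> real_stable (fix_right (Symb lam T) x)"
    and \<alpha>: "\<And>i. 0 \<le> \<alpha> $ i" "\<And>i. \<alpha> $ i \<le> real (lam $ i)"
    and \<beta>: "\<And>j. 0 \<le> \<beta> $ j"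
  shows "(\<forall>p\<in>nonneg_polys_le lam. real_stable p \<longrightarrow> \<alpha> \<in> Newt p \<longrightarrow>
            Cap \<beta> (T p) / Cap \<alpha> p
              \<ge> self_power \<alpha> * self_power (real_vec lam - \<alpha>) / self_power (real_vec lam)
                  * Cap (vec_join \<alpha> \<beta>) (Symb lam T))
       \<and> (INF p\<in>{p \<in> nonneg_polys_le lam. real_stable p \<and> \<alpha> \<in> Newt p}. Cap \<beta> (T p) / Cap \<alpha> p)
           = self_power \<alpha> * self_power (real_vec lam - \<alpha>) / self_power (real_vec lam)
               * Cap (vec_join \<alpha> \<beta>) (Symb lam T)"
proof -
  let ?C = "\<Prod>i\<in>UNIV. entropy_factor (\<alpha> $ i / real (lam $ i)) ^ (lam $ i)"
  let ?S = "Cap (vec_join \<alpha> \<beta>) (Symb lam T)"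
  let ?A = "{p \<in> nonneg_polys_le lam. real_stable p \<and> \<alpha> \<in> Newt p}"
  let ?r = "\<lambda>p. Cap \<beta> (T p) / Cap \<alpha> p"
  have C: "0 < ?C"
    using \<alpha> by (intro prod_pos) (auto intro!: zero_less_power entropy_factor_pos simp: divide_le_eq_1)
  have lower: "?C * ?S \<le> ?r p" if p: "p \<in> ?A" for p
  proof -
    have "p \<noteq> 0"
      using p by (auto simp: Newt_def)
    then have "Cap \<alpha> p * ?S * ?C \<le> Cap \<beta> (T p)"
      using p by (intro Cap_image_ge[OF T_linear T_nonneg symb_stable \<alpha>]) auto
    moreover have "0 < Cap \<alpha> p"
      using p by (auto intro: Cap_pos)
    ultimately show ?thesis
      by (simp add: field_simps)
  qed
  have binomial: "binomial_rpoly lam y \<in> ?A" if "\<And>i. 0 < y $ i" for y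
    using that \<alpha> by (simp add: binomial_rpoly_nonneg real_stable_binomial_rpoly Newt_binomial_rpoly)
  have bdd: "bdd_below (?r ` ?A)"
    using lower by (intro bdd_belowI2) auto
  \<comment> \<open>Tightness is checked pointwise: each positive point \<open>(y, x)\<close> at
    which the symbol is evaluated supplies its own test polynomial
    \<open>binomial_rpoly lam y\<close>.\<close>
  have "(INF p\<in>?A. ?r p) / ?C \<le> ?S"
  proof (rule Cap_ge)
    fix w :: "real ^ ('n + 'm)"
    assume w: "\<And>s. 0 < w $ s"
    define y x where "y = (\<chi> i. w $ Inl i)" and "x = (\<chi> j. w $ Inr j)"
    have w_eq: "w = vec_join y x"
      by (simp add: y_def x_def vec_eq_iff vec_join_def split: sum.split)
    have y: "0 < y $ i" and x: "0 < x $ j" for i j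
      using w by (simp_all add: y_def x_def)
    let ?p = "binomial_rpoly lam y"
    let ?Y = "\<Prod>i\<in>UNIV. (y $ i) powr (\<alpha> $ i)" and ?X = "\<Prod>j\<in>UNIV. (x $ j) powr (\<beta> $ j)"
    have Y: "0 < ?Y" and X: "0 < ?X"
      using x y by (simp_all add: prod_pos less_imp_neq[symmetric])
    have pA: "?p \<in> ?A"
      using binomial y .
    then have cap_p: "0 < Cap \<alpha> ?p"
      by (auto intro: Cap_pos)
    have Tp: "poly_eval (T ?p) x = poly_eval (Symb lam T) w"
      unfolding w_eq poly_eval_Symb binomial_rpoly_def
      by (subst linear_on_polys_le_sum[OF T_linear]) simp_all
    have nonneg: "0 \<le> poly_eval (T ?p) v" if "\<And>j. 0 < v $ j" for v :: "real ^ 'm"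
      using that poly_eval_nonneg[OF T_nonneg] pA by (auto simp: less_imp_le)
    have capT: "0 \<le> Cap \<beta> (T ?p)"
      using nonneg by (intro Cap_ge) simp
    have "(INF p\<in>?A. ?r p) * ?Y \<le> ?r ?p * ?Y"
      using Y bdd pA by (intro mult_right_mono cINF_lower) auto
    \<comment> \<open>The product of the \<open>(y $ i) powr (\<alpha> $ i)\<close> is traded for
      \<open>?C * Cap \<alpha> ?p\<close>, which cancels the denominator of the ratio.\<close>
    also have "\<dots> \<le> ?r ?p * (?C * Cap \<alpha> ?p)"
      using capT cap_p by (intro mult_left_mono Cap_binomial_rpoly_ge y \<alpha>) auto
    also have "\<dots> = ?C * Cap \<beta> (T ?p)"
      using cap_p by simp
    finally have "(INF p\<in>?A. ?r p) * ?Y * ?X \<le> ?C * Cap \<beta> (T ?p) * ?X"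
      using X by (intro mult_right_mono) auto
    also have "\<dots> \<le> ?C * poly_eval (Symb lam T) w"
      using C Cap_le[OF nonneg x] by (simp add: Tp mult.assoc)
    finally have "(INF p\<in>?A. ?r p) * (?Y * ?X) \<le> ?C * poly_eval (Symb lam T) w"
      by (simp only: mult.assoc)
    moreover have "(\<Prod>s\<in>UNIV. (w $ s) powr (vec_join \<alpha> \<beta> $ s)) = ?Y * ?X"
      by (simp add: w_eq prod_UNIV_sum_type)
    ultimately show "(INF p\<in>?A. ?r p) / ?C * (\<Prod>s\<in>UNIV. (w $ s) powr (vec_join \<alpha> \<beta> $ s))
        \<le> poly_eval (Symb lam T) w"
      using C by (simp add: field_simps)
  qed
  then have upper: "(INF p\<in>?A. ?r p) \<le> ?C * ?S"
    using C by (simp add: field_simps)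
  \<comment> \<open>Any member shows that the infimum is over a nonempty set, as its comparison with
    a lower bound requires.\<close>
  have "binomial_rpoly lam (\<chi> i. 1) \<in> ?A"
    by (rule binomial) simp
  then have "?C * ?S \<le> (INF p\<in>?A. ?r p)"
    using lower by (intro cINF_greatest) auto
  with upper have "(INF p\<in>?A. ?r p) = ?C * ?S"
    by (rule order.antisym)
  then show ?thesis
    unfolding self_power_ratio[OF \<alpha>] using lower by blast
qed

end
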